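(* Let $H$ be a nonzero complex Hilbert space, let $\Omega\subset H$ be a bounded domain and let $u,v\in\mathcal{PSH}(\Omega)\cap C^2(\overline\Omega)$. Assume that $mI\le D'D''v(z)\le MI$ for all $z\in\Omega$ and some constants $0<m\le M$. Suppose: (1) $u+C(m,M)\|z\|^2\le v$ on $\partial\Omega$; (2) for every $z\in\Omega$ and every unit vector $x\in H$, $\Delta_x(D'D''v(z))\le\Delta_x(D'D''u(z))$. Then $u+C(m,M)\|z\|^2-v$ is plurisubharmonic and nonpositive on $\Omega$. Here \[ C(m,M):=\frac{M-m}{\log M-\log m}\,\log S\!\left(\frac Mm\right)\ \text{ if } m<M,\qquad C(m,M):=0\ \text{ if } m=M . \]
   Context: The inner product of $H$ is linear in the first variable; $A\ge B$ for self-adjoint operators means $\langle(A-B)x,x\rangle\ge0$ for all $x$. Specht's ratio: $S(h):=\frac{(h-1)h^{1/(h-1)}}{e\log h}$ for $h>0$, $h\ne1$, and $S(1):=1$. Plurisubharmonic: for $\Omega\subset H$ open, $\mathcal{PSH}(\Omega)$ is the set of upper semicontinuous $u:\Omega\to[-\infty,\infty)$, not identically $-\infty$ on any component of $\Omega$, such that $u(z)\le\frac1{2\pi}\int_0^{2\pi}u(z+e^{i\theta}h)\,d\theta$ whenever $z\in\Omega$, $h\in H$ and $z+\lambda h\in\Omega$ for all $|\lambda|\le1$. $C^2(\overline\Omega)$ denotes functions on $\overline\Omega$ of class $C^2$ up to the boundary (of class $C^2$ in $\Omega$, with the function and its derivatives up to order two extending continuously to $\overline\Omega$). Levi form: for a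 $C^2$ function $u$ with second real Fréchet differential $D^2u(a)$, $4D'D''u(a)(s,t)=D^2u(a)(s,t)+D^2u(a)(is,it)+iD^2u(a)(s,it)-iD^2u(a)(is,t)$; this form is identified with the bounded operator $D'D''u(a)$ given by $\langle D'D''u(a)s,t\rangle=D'D''u(a)(s,t)$ (so $D'D''\|z\|^2=I$). For $u$ plurisubharmonic this operator is positive. Fujii--Seo determinant: for a bounded positive operator $A\ge0$ and a unit vector $x$, $\Delta_x(A):=\exp\bigl(\lim_{\varepsilon\to0^+}\langle\log(A+\varepsilon I)x,x\rangle\bigr)$, with $\exp(-\infty)=0$ (this equals $\exp(\langle(\log A)x,x\rangle)$ if $A$ is invertible). *)

theory Defs
  imports "HOL-Analysis.Analysis" "HOL-Computational_Algebra.Polynomial"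
begin

text \<open>
  A complex Hilbert space: a complete real inner product space with a compatible complex
  structure. The complex inner product is linear in its first argument; its real part is the
  ambient \<^const>\<open>inner\<close>, so positivity and norm of x = sqrt (Re (cinner x x)) are inherited
  from \<^class>\<open>real_inner\<close>.
\<close>

class complex_hilbert = real_inner + complete_space +
  fixes scaleC :: "complex \<Rightarrow> 'a \<Rightarrow> 'a"
    and cinner :: "'a \<Rightarrow> 'a \<Rightarrow> complex"
  assumes scaleC_add_right: "scaleC a (x + y) = scaleC a x + scaleC a y"
    and scaleC_add_left: "scaleC (a + b) x = scaleC a x + scaleC b x"
    and scaleC_scaleC: "scaleC a (scaleC b x) = scaleC (a * b) x"
    and scaleC_of_real: "scaleC (complex_of_real r) x = scaleR r x"
    and cinner_add_left: "cinner (x + y) z = cinner x z + cinner y z"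
    and cinner_scaleC_left: "cinner (scaleC a x) y = a * cinner x y"
    and cinner_commute: "cinner x y = cnj (cinner y x)"
    and inner_eq_Re_cinner: "inner x y = Re (cinner x y)"

instantiation complex :: complex_hilbert
begin

definition scaleC_complex :: "complex \<Rightarrow> complex \<Rightarrow> complex"
  where "scaleC_complex a x = a * x"

definition cinner_complex :: "complex \<Rightarrow> complex \<Rightarrow> complex"
  where "cinner_complex x y = x * cnj y"

instance
  by standard
    (auto simp: scaleC_complex_def cinner_complex_def inner_complex_def scaleR_conv_of_real
      algebra_simps)

end

definition op_le :: "('a::complex_hilbert \<Rightarrow>\<^sub>L 'a) \<Rightarrow> ('a \<Rightarrow>\<^sub>L 'a) \<Rightarrow> bool"
  where "op_le B A \<longleftrightarrow> (\<forall>x. cinner (blinfun_apply (A - B) x) x \<in> \<real>\<^sub>\<ge>\<^sub>0)"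

definition op_invertible :: "('a::complex_hilbert \<Rightarrow>\<^sub>L 'a) \<Rightarrow> bool"
  where "op_invertible A \<longleftrightarrow> (\<exists>B. A o\<^sub>L B = id_blinfun \<and> B o\<^sub>L A = id_blinfun)"

definition op_spectrum :: "('a::complex_hilbert \<Rightarrow>\<^sub>L 'a) \<Rightarrow> complex set"
  where "op_spectrum A = {l. \<not> op_invertible (A - Blinfun (scaleC l))}"

definition op_poly :: "real poly \<Rightarrow> ('a::complex_hilbert \<Rightarrow>\<^sub>L 'a) \<Rightarrow> ('a \<Rightarrow>\<^sub>L 'a)"
  where "op_poly p A = (\<Sum>k\<le>degree p. coeff p k *\<^sub>R (((o\<^sub>L) A ^^ k) id_blinfun))"

text \<open>
  Continuous functional calculus for a self-adjoint operator A (whose spectrum is real) and f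
  continuous on the spectrum of A: the operator-norm limit of p n (A) whenever the real
  polynomials p n converge to f uniformly on the spectrum.
\<close>

definition fun_calc :: "(real \<Rightarrow> real) \<Rightarrow> ('a::complex_hilbert \<Rightarrow>\<^sub>L 'a) \<Rightarrow> ('a \<Rightarrow>\<^sub>L 'a)"
  where "fun_calc f A = (THE B. \<forall>p :: nat \<Rightarrow> real poly.
     uniform_limit {t. complex_of_real t \<in> op_spectrum A} (\<lambda>n. poly (p n)) f sequentially
       \<longrightarrow> (\<lambda>n. op_poly (p n) A) \<longlonglongrightarrow> B)"

definition op_log :: "('a::complex_hilbert \<Rightarrow>\<^sub>L 'a) \<Rightarrow> ('a \<Rightarrow>\<^sub>L 'a)"
  where "op_log A = fun_calc ln A"

definition exp_ereal :: "ereal \<Rightarrow> ereal"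
  where "exp_ereal a =
    (if a = \<infinity> then \<infinity> else if a = -\<infinity> then 0 else ereal (exp (real_of_ereal a)))"

text \<open>
  The Fujii--Seo determinant, for positive A and a unit vector x. The limit is taken in
  \<^typ>\<open>ereal\<close>, since it may be minus infinity; the inner product is real there.
\<close>

definition fs_det :: "'a::complex_hilbert \<Rightarrow> ('a \<Rightarrow>\<^sub>L 'a) \<Rightarrow> ereal"
  where "fs_det x A = exp_ereal (Lim (at_right 0)
     (\<lambda>\<epsilon>::real. ereal (Re (cinner (blinfun_apply (op_log (A + \<epsilon> *\<^sub>R id_blinfun)) x) x))))"

definition specht :: "real \<Rightarrow> real"
  where "specht h = (if h = 1 then 1 else (h - 1) * h powr (1 / (h - 1)) / (exp 1 * ln h))"

definition specht_const :: "real \<Rightarrow> real \<Rightarrow> real"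
  where "specht_const m M =
    (if m < M then (M - m) / (ln M - ln m) * ln (specht (M / m)) else 0)"

text \<open>
  Lebesgue integral of an extended real function whose positive part has finite integral, as
  the difference of the integrals of its positive and negative parts (\<^const>\<open>e2ennreal\<close> sends
  negative numbers to 0); the value minus infinity is allowed.
\<close>

definition ereal_integral :: "real set \<Rightarrow> (real \<Rightarrow> ereal) \<Rightarrow> ereal"
  where "ereal_integral S f =
     enn2ereal (\<integral>\<^sup>+ \<theta>\<in>S. e2ennreal (f \<theta>) \<partial>lborel) - enn2ereal (\<integral>\<^sup>+ \<theta>\<in>S. e2ennreal (- f \<theta>) \<partial>lborel)"

definition usc_on :: "'a::topological_space set \<Rightarrow> ('a \<Rightarrow> ereal) \<Rightarrow> bool"
  where "usc_on S u \<longleftrightarrow> (\<forall>z\<in>S. \<forall>c. u z < c \<longrightarrow> (\<forall>\<^sub>F w in at z within S. u w < c))"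

definition psh :: "'a::complex_hilbert set \<Rightarrow> ('a \<Rightarrow> ereal) \<Rightarrow> bool"
  where "psh \<Omega> u \<longleftrightarrow>
     (\<forall>z\<in>\<Omega>. u z \<noteq> \<infinity>) \<and>
     usc_on \<Omega> u \<and>
     (\<forall>K\<in>components \<Omega>. \<exists>z\<in>K. u z \<noteq> -\<infinity>) \<and>
     (\<forall>z\<in>\<Omega>. \<forall>h. (\<forall>l::complex. cmod l \<le> 1 \<longrightarrow> z + scaleC l h \<in> \<Omega>) \<longrightarrow>
        u z \<le> ereal (1 / (2 * pi)) *
                ereal_integral {0..2 * pi} (\<lambda>\<theta>. u (z + scaleC (cis \<theta>) h)))"

definition D1 :: "('a::complex_hilbert \<Rightarrow> real) \<Rightarrow> 'a \<Rightarrow> ('a \<Rightarrow>\<^sub>L real)"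
  where "D1 u a = Blinfun (frechet_derivative u (at a))"

definition D2 :: "('a::complex_hilbert \<Rightarrow> real) \<Rightarrow> 'a \<Rightarrow> ('a \<Rightarrow>\<^sub>L ('a \<Rightarrow>\<^sub>L real))"
  where "D2 u a = Blinfun (frechet_derivative (D1 u) (at a))"

text \<open>
  Class C2 up to the boundary, for open \<open>\<Omega>\<close>; only the values of u on the closure matter. Continuity
  of u, D1 u and D2 u on \<open>\<Omega>\<close> itself is part of the existence of the continuous extensions.
\<close>

definition C2_closure :: "'a::complex_hilbert set \<Rightarrow> ('a \<Rightarrow> real) \<Rightarrow> bool"
  where "C2_closure \<Omega> u \<longleftrightarrow>
     (\<forall>z\<in>\<Omega>. u differentiable (at z) \<and> D1 u differentiable (at z)) \<and>
     continuous_on (closure \<Omega>) u \<and>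
     (\<exists>G. continuous_on (closure \<Omega>) G \<and> (\<forall>z\<in>\<Omega>. G z = D1 u z)) \<and>
     (\<exists>G. continuous_on (closure \<Omega>) G \<and> (\<forall>z\<in>\<Omega>. G z = D2 u z))"

definition levi_form :: "('a::complex_hilbert \<Rightarrow> real) \<Rightarrow> 'a \<Rightarrow> 'a \<Rightarrow> 'a \<Rightarrow> complex"
  where "levi_form u a s t =
     (let B = (\<lambda>p q. complex_of_real (blinfun_apply (blinfun_apply (D2 u a) p) q));
          J = scaleC \<i>
      in (B s t + B (J s) (J t) + \<i> * B s (J t) - \<i> * B (J s) t) / 4)"

definition levi_op :: "('a::complex_hilbert \<Rightarrow> real) \<Rightarrow> 'a \<Rightarrow> ('a \<Rightarrow>\<^sub>L 'a)"
  where "levi_op u a = (THE A. \<forall>s t. cinner (blinfun_apply A s) t = levi_form u a s t)"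

end

theory Submission
  imports Defs "HOL-Computational_Algebra.Fundamental_Theorem_Algebra"
begin

text \<open>
  Write \<open>A\<close> and \<open>B\<close> for the Levi operators of \<open>u\<close> and \<open>v\<close> at a point and \<open>C\<close> for the Specht
  constant. The theorem is a pointwise operator inequality \<open>B \<le> A + C I\<close> followed by potential
  theory on complex lines.

  For a unit vector \<open>x\<close> the chain is
  \<open>\<langle>B x, x\<rangle> - C \<le> exp \<langle>(log B) x, x\<rangle> \<le> \<Delta>\<^sub>x(B) \<le> \<Delta>\<^sub>x(A) \<le> \<langle>A x, x\<rangle>\<close>.
  The last step is Jensen's inequality: the logarithm lies below its tangent at the mean value
  \<open>\<langle>A x, x\<rangle>\<close> (\<open>fs_det_le_inner\<close>). The first is the reverse Jensen inequality of Mond and Pecaric: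
  on \<open>[m, M]\<close> the logarithm lies above its chord, and \<open>C\<close> is exactly the largest gap
  between the identity and the exponential of that chord (\<open>specht_const_chord_bound\<close>). Both need only
  that the functional calculus is monotone, which rests on one fact: a real polynomial that is
  nonnegative on the spectrum of a symmetric operator gives a nonnegative operator
  (\<open>op_poly_nonneg\<close>). It is proved without spectral measures: the infimum of the quadratic form of
  \<open>q(A)\<close> on the unit sphere is a number \<open>c\<close> for which \<open>q(A) - c\<close> is not invertible, so one of the
  real linear or quadratic factors of \<open>q - c\<close> is not invertible at \<open>A\<close>; the quadratic ones always
  are, hence \<open>q - c\<close> has a root in the spectrum. Symmetry of \<open>A\<close> is the symmetry of second
  derivatives, and its existence is the Riesz representation theorem.

  Since the Levi operator of \<open>\<parallel>z\<parallel>\<^sup>2\<close> is the identity, \<open>w = u + C \<parallel>z\<parallel>\<^sup>2 - v\<close> has a nonnegative Levi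
  form. Restricted to a complex line this means a nonnegative Laplacian, and then circle means
  increase with the radius (\<open>subharmonic_le_circle_mean\<close>), which gives plurisubharmonicity. The same
  mean value inequality, applied to \<open>- u - c \<parallel>y - z\<parallel>\<^sup>2\<close> on a small disc, shows conversely that the Levi
  form of a plurisubharmonic function is nonnegative, as the Jensen step requires. Finally
  \<open>w \<le> 0\<close> by the maximum principle on the slice of \<open>\<Omega>\<close> by a complex line, which is a bounded subset of
  the plane and so has compact closure even if \<open>H\<close> is infinite-dimensional.
\<close>

section \<open>Coercive operators\<close>

instance complex_hilbert \<subseteq> banach ..

text \<open>
  Symmetry for the underlying real inner product is what the order arguments use. For a
  complex-linear operator it is the same as self-adjointness.
\<close>

definition op_symmetric :: "('a::complex_hilbert \<Rightarrow>\<^sub>L 'a) \<Rightarrow> bool"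
  where "op_symmetric A \<longleftrightarrow> (\<forall>x y. inner (A x) y = inner x (A y))"

lemma op_symmetricD: "op_symmetric A \<Longrightarrow> inner (blinfun_apply A x) y = inner x (blinfun_apply A y)"
  by (simp add: op_symmetric_def)

lemma coercive_norm_bound:
  fixes T :: "'a::complex_hilbert \<Rightarrow>\<^sub>L 'a"
  assumes "\<And>x. d * (norm x)\<^sup>2 \<le> inner (T x) x"
  shows "d * norm x \<le> norm (T x)"
proof (cases "x = 0")
  case False
  have "d * (norm x)\<^sup>2 \<le> norm (T x) * norm x"
    using assms[of x] norm_cauchy_schwarz[of "T x" x] by linarith
  then have "(d * norm x) * norm x \<le> norm (T x) * norm x"
    by (simp add: power2_eq_square mult.assoc)
  then show ?thesis
    using False by (simp add: mult_le_cancel_right)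
qed simp

text \<open>
  For a small step \<open>c\<close> the map \<open>x \<mapsto> x - c (T x - y)\<close> is a contraction, because coercivity makes
  \<open>I - c T\<close> shrink norms by the factor \<open>q\<close>; its fixed point solves \<open>T x = y\<close>. The step
  \<open>c = d / N\<^sup>2\<close> minimises the bound \<open>1 - 2 c d + c\<^sup>2 N\<^sup>2\<close> for \<open>q\<^sup>2\<close>.
\<close>

lemma coercive_surj:
  fixes T :: "'a::complex_hilbert \<Rightarrow>\<^sub>L 'a"
  assumes d: "d > 0" and coercive: "\<And>x. d * (norm x)\<^sup>2 \<le> inner (T x) x"
  shows "\<exists>x. T x = y"
proof -
  define N where "N = norm T + d"
  define c where "c = d / N\<^sup>2"
  define q where "q = sqrt (1 - d\<^sup>2 / N\<^sup>2)"
  have N: "N > 0" "norm T \<le> N" "d \<le> N" using d by (auto simp: N_def add_nonneg_pos)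
  have c: "c > 0" using d N by (simp add: c_def)
  have dN: "0 < d\<^sup>2 / N\<^sup>2" "d\<^sup>2 / N\<^sup>2 \<le> 1"
    using d N by (auto simp: divide_le_eq_1 power_mono)
  have q: "0 \<le> q" "q < 1" using dN by (auto simp: q_def)
  have contr: "norm (x - c *\<^sub>R T x) \<le> q * norm x" for x
  proof -
    have "(norm (x - c *\<^sub>R T x))\<^sup>2 = (norm x)\<^sup>2 - 2 * c * inner (T x) x + c\<^sup>2 * (norm (T x))\<^sup>2"
      unfolding power2_norm_eq_inner
      by (simp add: inner_diff_left inner_diff_right inner_commute power2_eq_square)
    also have "\<dots> \<le> (norm x)\<^sup>2 - 2 * c * (d * (norm x)\<^sup>2) + c\<^sup>2 * (N * norm x)\<^sup>2"
    proof -
      have "norm (T x) \<le> N * norm x"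
        using norm_blinfun[of T x] N(2) by (meson mult_right_mono norm_ge_zero order_trans)
      then have "(norm (T x))\<^sup>2 \<le> (N * norm x)\<^sup>2" by (intro power_mono) auto
      then have "c\<^sup>2 * (norm (T x))\<^sup>2 \<le> c\<^sup>2 * (N * norm x)\<^sup>2" by (intro mult_left_mono) auto
      moreover have "2 * c * (d * (norm x)\<^sup>2) \<le> 2 * c * inner (T x) x"
        using coercive[of x] c by (intro mult_left_mono) auto
      ultimately show ?thesis by linarith
    qed
    also have "\<dots> = (1 - d\<^sup>2 / N\<^sup>2) * (norm x)\<^sup>2"
      using N by (simp add: c_def field_simps power2_eq_square)
    also have "\<dots> = (q * norm x)\<^sup>2"
      using dN by (simp add: q_def power_mult_distrib)
    finally show ?thesis
      by (rule power2_le_imp_le) (simp add: q)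
  qed
  have "\<exists>!x. x - c *\<^sub>R (T x - y) = x"
  proof (rule banach_fix_type[OF q], intro allI)
    fix x z
    have "dist (x - c *\<^sub>R (T x - y)) (z - c *\<^sub>R (T z - y)) = norm ((x - z) - c *\<^sub>R T (x - z))"
      by (simp add: dist_norm blinfun.diff_right algebra_simps)
    then show "dist (x - c *\<^sub>R (T x - y)) (z - c *\<^sub>R (T z - y)) \<le> q * dist x z"
      using contr[of "x - z"] by (simp add: dist_norm)
  qed
  then show ?thesis using c by auto
qed

lemma coercive_invertible:
  fixes T :: "'a::complex_hilbert \<Rightarrow>\<^sub>L 'a"
  assumes d: "d > 0" and coercive: "\<And>x. d * (norm x)\<^sup>2 \<le> inner (T x) x"
  shows "op_invertible T"
proof -
  obtain S where S: "\<And>y. T (S y) = y"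
    using coercive_surj[OF assms] by metis
  have inj: "x = y" if "T x = T y" for x y
    using coercive_norm_bound[of d T "x - y", OF coercive] d that
    by (simp add: blinfun.diff_right mult_le_0_iff)
  have "bounded_linear S"
  proof (rule bounded_linear_intro[where K = "1 / d"])
    show "S (x + y) = S x + S y" for x y
      by (rule inj) (simp add: S blinfun.add_right)
    show "S (r *\<^sub>R x) = r *\<^sub>R S x" for r x
      by (rule inj) (simp add: S blinfun.scaleR_right)
    show "norm (S x) \<le> norm x * (1 / d)" for x
      using coercive_norm_bound[of d T "S x", OF coercive] d by (simp add: S field_simps)
  qed
  then have "T o\<^sub>L Blinfun S = id_blinfun \<and> Blinfun S o\<^sub>L T = id_blinfun"
    by (auto intro!: blinfun_eqI simp: bounded_linear_Blinfun_apply S inj[OF S])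
  then show ?thesis unfolding op_invertible_def by blast
qed

text \<open>
  The converse of \<open>coercive_invertible\<close> for positive symmetric operators: the Cauchy--Schwarz
  inequality for the form of \<open>T\<close> gives \<open>\<parallel>T x\<parallel>\<^sup>2 \<le> \<parallel>T\<parallel> \<langle>T x, x\<rangle>\<close>, and an inverse bounds \<open>\<parallel>x\<parallel>\<close> by \<open>\<parallel>T x\<parallel>\<close>.
  One is added to the norms so that the constants stay positive on the zero space.
\<close>

lemma positive_invertible_coercive:
  fixes T :: "'a::complex_hilbert \<Rightarrow>\<^sub>L 'a"
  assumes sym: "op_symmetric T" and pos: "\<And>x. 0 \<le> inner (T x) x" and inv: "op_invertible T"
  shows "\<exists>d>0. \<forall>x. d * (norm x)\<^sup>2 \<le> inner (T x) x"
proof -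
  obtain S where S: "S o\<^sub>L T = id_blinfun"
    using inv unfolding op_invertible_def by blast
  define K where "K = (norm T + 1) * (norm S + 1)\<^sup>2"
  have K: "K > 0" unfolding K_def by (intro mult_pos_pos zero_less_power add_nonneg_pos) auto
  have "(norm x)\<^sup>2 \<le> K * inner (T x) x" for x
  proof -
    define t where "t = 1 / (norm T + 1)"
    have t: "t > 0" by (simp add: t_def add_nonneg_pos)
    \<comment> \<open>Expanding positivity of the form at \<open>x - t T x\<close> is Cauchy--Schwarz for the form of \<open>T\<close>.\<close>
    have "0 \<le> inner (T (x - t *\<^sub>R T x)) (x - t *\<^sub>R T x)" by (rule pos)
    also have "\<dots> = inner (T x) x - 2 * t * (norm (T x))\<^sup>2 + t\<^sup>2 * inner (T (T x)) (T x)"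
      using op_symmetricD[OF sym, of "T x" x]
      by (simp add: blinfun.diff_right blinfun.scaleR_right inner_diff_left inner_diff_right
          power2_norm_eq_inner inner_commute) (simp add: power2_eq_square algebra_simps)
    also have "t\<^sup>2 * inner (T (T x)) (T x) \<le> t\<^sup>2 * ((norm T + 1) * (norm (T x))\<^sup>2)"
    proof (rule mult_left_mono)
      have "inner (T (T x)) (T x) \<le> norm (T (T x)) * norm (T x)" by (rule norm_cauchy_schwarz)
      also have "\<dots> \<le> (norm T * norm (T x)) * norm (T x)"
        by (intro mult_right_mono norm_blinfun) auto
      also have "\<dots> \<le> (norm T + 1) * (norm (T x))\<^sup>2"
        by (simp add: power2_eq_square algebra_simps)
      finally show "inner (T (T x)) (T x) \<le> (norm T + 1) * (norm (T x))\<^sup>2" .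
    qed simp
    also have "t\<^sup>2 * ((norm T + 1) * (norm (T x))\<^sup>2) = t * (norm (T x))\<^sup>2"
      by (simp add: t_def power2_eq_square)
    finally have "t * (norm (T x))\<^sup>2 \<le> inner (T x) x" by simp
    then have 1: "(norm (T x))\<^sup>2 \<le> (norm T + 1) * inner (T x) x"
      using t by (simp add: t_def divide_le_eq mult_ac add_nonneg_pos)
    have "x = S (T x)" using arg_cong[OF S, of "\<lambda>f. blinfun_apply f x"] by simp
    then have "norm x \<le> norm S * norm (T x)"
      using norm_blinfun[of S "T x"] by metis
    also have "\<dots> \<le> (norm S + 1) * norm (T x)" by (simp add: algebra_simps)
    finally have "norm x \<le> (norm S + 1) * norm (T x)" .
    then have "(norm x)\<^sup>2 \<le> ((norm S + 1) * norm (T x))\<^sup>2" by (intro power_mono) auto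
    also have "\<dots> \<le> (norm S + 1)\<^sup>2 * ((norm T + 1) * inner (T x) x)"
      using 1 by (simp add: power_mult_distrib mult_left_mono)
    finally show ?thesis by (simp add: K_def mult_ac)
  qed
  then have "\<forall>x. (1 / K) * (norm x)\<^sup>2 \<le> inner (T x) x"
    using K by (simp add: field_simps)
  with K show ?thesis by (meson divide_pos_pos zero_less_one)
qed

section \<open>Polynomials of an operator\<close>

lemma op_poly_bound:
  assumes "degree p \<le> n"
  shows "op_poly p A = (\<Sum>k\<le>n. coeff p k *\<^sub>R (((o\<^sub>L) A ^^ k) id_blinfun))"
  unfolding op_poly_def using assms
  by (intro sum.mono_neutral_left) (auto simp: coeff_eq_0)

lemma op_poly_0 [simp]: "op_poly 0 A = 0"
  by (simp add: op_poly_def)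

text \<open>
  Horner's rule; all algebraic laws of \<open>op_poly\<close> follow from it by induction over polynomials.
\<close>

lemma op_poly_pCons: "op_poly (pCons c p) A = c *\<^sub>R id_blinfun + (A o\<^sub>L op_poly p A)"
proof -
  have "op_poly (pCons c p) A = (\<Sum>k\<le>Suc (degree p). coeff (pCons c p) k *\<^sub>R (((o\<^sub>L) A ^^ k) id_blinfun))"
    by (rule op_poly_bound[OF degree_pCons_le])
  also have "\<dots> = c *\<^sub>R id_blinfun + (\<Sum>k\<le>degree p. coeff p k *\<^sub>R (A o\<^sub>L (((o\<^sub>L) A ^^ k) id_blinfun)))"
    by (simp only: sum.atMost_Suc_shift coeff_pCons_0 coeff_pCons_Suc funpow.simps o_apply id_apply)
  also have "(\<Sum>k\<le>degree p. coeff p k *\<^sub>R (A o\<^sub>L (((o\<^sub>L) A ^^ k) id_blinfun))) = A o\<^sub>L op_poly p A"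
    by (simp add: op_poly_def bounded_bilinear.sum_right[OF bounded_bilinear_blinfun_compose]
        bounded_bilinear.scaleR_right[OF bounded_bilinear_blinfun_compose])
  finally show ?thesis .
qed

lemma op_poly_pCons_apply: "op_poly (pCons c p) A x = c *\<^sub>R x + A (op_poly p A x)"
  by (simp add: op_poly_pCons blinfun.add_left blinfun.scaleR_left)

lemma op_poly_add: "op_poly (p + q) A = op_poly p A + op_poly q A"
  by (induction p q rule: poly_induct2)
    (auto intro!: blinfun_eqI simp: op_poly_pCons_apply blinfun.add_left blinfun.add_right algebra_simps)

lemma op_poly_smult: "op_poly (smult c p) A = c *\<^sub>R op_poly p A"
  by (induction p)
    (auto intro!: blinfun_eqI simp: op_poly_pCons_apply blinfun.scaleR_left blinfun.scaleR_right
      scaleR_add_right)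

lemma op_poly_diff: "op_poly (p - q) A = op_poly p A - op_poly q A"
  using op_poly_add[of "p - q" q A] by simp

lemma op_poly_commute: "op_poly p A (A x) = A (op_poly p A x)"
  by (induction p arbitrary: x) (auto simp: op_poly_pCons_apply blinfun.add_right blinfun.scaleR_right)

lemma op_poly_mult_apply: "op_poly (p * q) A x = op_poly p A (op_poly q A x)"
  by (induction p arbitrary: x)
    (auto simp: op_poly_pCons_apply op_poly_add op_poly_smult blinfun.add_left blinfun.scaleR_left)

lemma op_poly_mult: "op_poly (p * q) A = op_poly p A o\<^sub>L op_poly q A"
  by (rule blinfun_eqI) (simp add: op_poly_mult_apply)

lemma op_poly_const: "op_poly [:c:] A = c *\<^sub>R id_blinfun"
  by (simp add: op_poly_pCons)

lemma op_poly_linear: "op_poly [:c, d:] A = c *\<^sub>R id_blinfun + d *\<^sub>R A"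
  by (rule blinfun_eqI) (simp add: op_poly_pCons_apply blinfun.add_left blinfun.scaleR_left blinfun.scaleR_right)

lemma op_poly_pcompose: "op_poly (pcompose p q) A = op_poly p (op_poly q A)"
  by (induction p)
    (auto simp: pcompose_pCons op_poly_add op_poly_const op_poly_mult op_poly_pCons)

lemma op_symmetric_poly:
  assumes "op_symmetric A" shows "op_symmetric (op_poly p A)"
  unfolding op_symmetric_def
proof (induction p)
  case (pCons c p)
  then show ?case
    using op_symmetricD[OF assms]
    by (auto simp: op_poly_pCons_apply inner_add_left inner_add_right op_poly_commute)
qed simp

section \<open>Spectral mapping for real polynomials\<close>

text \<open>
  The set over which the functional calculus asks for uniform convergence.
\<close>

definition real_spectrum :: "('a::complex_hilbert \<Rightarrow>\<^sub>L 'a) \<Rightarrow> real set"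
  where "real_spectrum A = {t. complex_of_real t \<in> op_spectrum A}"

lemma real_spectrum_iff:
  fixes A :: "'a::complex_hilbert \<Rightarrow>\<^sub>L 'a"
  shows "t \<in> real_spectrum A \<longleftrightarrow> \<not> op_invertible (A - t *\<^sub>R id_blinfun)"
proof -
  have "bounded_linear (\<lambda>x::'a. scaleR t x)" by (rule bounded_linear_scaleR_right)
  then have "Blinfun (scaleC (complex_of_real t)) = t *\<^sub>R (id_blinfun :: 'a \<Rightarrow>\<^sub>L 'a)"
    by (intro blinfun_eqI)
      (simp add: bounded_linear_Blinfun_apply blinfun.scaleR_left scaleC_of_real[abs_def])
  then show ?thesis by (simp add: real_spectrum_def op_spectrum_def)
qed

lemma op_invertible_compose:
  assumes "op_invertible S" "op_invertible T"
  shows "op_invertible (S o\<^sub>L T)"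
proof -
  obtain S' T' where "S o\<^sub>L S' = id_blinfun" "S' o\<^sub>L S = id_blinfun"
    "T o\<^sub>L T' = id_blinfun" "T' o\<^sub>L T = id_blinfun"
    using assms unfolding op_invertible_def by blast
  then have e: "S (S' x) = x" "S' (S x) = x" "T (T' x) = x" "T' (T x) = x" for x
    by (metis blinfun_apply_blinfun_compose id_blinfun.rep_eq)+
  have "(S o\<^sub>L T) o\<^sub>L (T' o\<^sub>L S') = id_blinfun \<and> (T' o\<^sub>L S') o\<^sub>L (S o\<^sub>L T) = id_blinfun"
    by (auto intro!: blinfun_eqI simp: e)
  then show ?thesis unfolding op_invertible_def by blast
qed

lemma op_invertible_scaleR:
  fixes A :: "'a::complex_hilbert \<Rightarrow>\<^sub>L 'a"
  assumes "op_invertible A" "c \<noteq> 0" shows "op_invertible (c *\<^sub>R A)"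
proof -
  obtain B where B: "A o\<^sub>L B = id_blinfun" "B o\<^sub>L A = id_blinfun"
    using assms unfolding op_invertible_def by blast
  then have e: "A (B x) = x" "B (A x) = x" for x
    by (metis blinfun_apply_blinfun_compose id_blinfun.rep_eq)+
  have "(c *\<^sub>R A) o\<^sub>L ((1 / c) *\<^sub>R B) = id_blinfun \<and> ((1 / c) *\<^sub>R B) o\<^sub>L (c *\<^sub>R A) = id_blinfun"
    using assms(2) by (auto intro!: blinfun_eqI simp: e blinfun.scaleR_left blinfun.scaleR_right)
  then show ?thesis unfolding op_invertible_def by blast
qed

lemma op_invertible_id: "op_invertible id_blinfun"
  unfolding op_invertible_def by (intro exI[of _ id_blinfun] conjI blinfun_eqI) auto

lemma poly_map_of_real_pCons:
  "poly (map_poly complex_of_real (pCons c p)) z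
    = complex_of_real c + z * poly (map_poly complex_of_real p) z"
  by (simp add: map_poly_pCons)

lemma poly_map_of_real_add:
  "poly (map_poly complex_of_real (p + q)) z
    = poly (map_poly complex_of_real p) z + poly (map_poly complex_of_real q) z"
  by (induction p q rule: poly_induct2) (simp_all add: poly_map_of_real_pCons algebra_simps)

lemma poly_map_of_real_smult:
  "poly (map_poly complex_of_real (smult c p)) z
    = complex_of_real c * poly (map_poly complex_of_real p) z"
  by (induction p) (simp_all add: poly_map_of_real_pCons algebra_simps)

lemma poly_map_of_real_mult:
  "poly (map_poly complex_of_real (p * q)) z
    = poly (map_poly complex_of_real p) z * poly (map_poly complex_of_real q) z"
  by (induction p)
    (simp_all add: poly_map_of_real_pCons poly_map_of_real_add poly_map_of_real_smult algebra_simps)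

lemma poly_map_of_real:
  "poly (map_poly complex_of_real p) (complex_of_real t) = complex_of_real (poly p t)"
  by (induction p) (simp_all add: poly_map_of_real_pCons)

text \<open>
  A complex root \<open>z = a + i b\<close> with \<open>b \<noteq> 0\<close> is also a root of the real quadratic
  \<open>t\<^sup>2 - 2 a t + a\<^sup>2 + b\<^sup>2\<close>. The remainder of \<open>q\<close> modulo this quadratic is linear with real
  coefficients and vanishes at \<open>z\<close>, so it is zero.
\<close>

lemma real_poly_has_factor:
  fixes q :: "real poly"
  assumes "degree q > 0"
  shows "(\<exists>t. [:-t, 1:] dvd q) \<or> (\<exists>a b. b \<noteq> 0 \<and> [:a\<^sup>2 + b\<^sup>2, -2 * a, 1:] dvd q)"
proof -
  define Q where "Q = map_poly complex_of_real q"
  have "degree Q = degree q" unfolding Q_def by (rule degree_map_poly) auto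
  then have "\<not> constant (poly Q)" using assms by (simp add: constant_degree)
  then obtain z where z: "poly Q z = 0" using fundamental_theorem_of_algebra by blast
  show ?thesis
  proof (cases "Im z = 0")
    case True
    then have "z = complex_of_real (Re z)" by (simp add: complex_eq_iff)
    then have "complex_of_real (poly q (Re z)) = 0"
      using z unfolding Q_def by (metis poly_map_of_real)
    then have "[:-Re z, 1:] dvd q" by (simp add: poly_eq_0_iff_dvd)
    then show ?thesis by blast
  next
    case False
    define a b where "a = Re z" and "b = Im z"
    define d where "d = [:a\<^sup>2 + b\<^sup>2, -2 * a, 1:]"
    define r where "r = q mod d"
    have "degree d = 2" by (simp add: d_def)
    have "degree r \<le> 1"
      using degree_mod_less[of d q] \<open>degree d = 2\<close> unfolding r_def by force
    then obtain c0 c1 where r: "r = [:c0, c1:]"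
      by (metis (no_types) One_nat_def degree_0 degree_pCons_eq_if le_zero_eq not_less_eq_eq pCons_cases
          degree_eq_zeroE Suc_le_mono)
    have "q = d * (q div d) + r" unfolding r_def by simp
    then have "poly Q z = poly (map_poly complex_of_real d) z * poly (map_poly complex_of_real (q div d)) z
        + poly (map_poly complex_of_real r) z"
      unfolding Q_def by (metis poly_map_of_real_add poly_map_of_real_mult)
    moreover have "poly (map_poly complex_of_real d) z = 0"
      by (simp add: d_def poly_map_of_real_pCons a_def b_def complex_eq_iff power2_eq_square algebra_simps)
    ultimately have "poly (map_poly complex_of_real r) z = 0"
      using z by simp
    then have "c0 + c1 * a = 0 \<and> c1 * b = 0"
      by (simp add: r poly_map_of_real_pCons complex_eq_iff a_def b_def mult.commute)
    then have "r = 0" using False by (auto simp: r b_def)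
    then have "d dvd q" by (simp add: r_def mod_eq_0_iff_dvd)
    then show ?thesis using False unfolding d_def b_def by blast
  qed
qed

text \<open>
  The operator is \<open>(A - a)\<^sup>2 + b\<^sup>2\<close>, which is coercive when \<open>A\<close> is symmetric. It expresses
  that a symmetric operator has no spectrum off the real line.
\<close>

lemma op_poly_quadratic_invertible:
  assumes sym: "op_symmetric A" and b: "b \<noteq> 0"
  shows "op_invertible (op_poly [:a\<^sup>2 + b\<^sup>2, -2 * a, 1:] A)"
proof (rule coercive_invertible)
  show "0 < b\<^sup>2" using b by simp
  fix x
  have "inner (op_poly [:a\<^sup>2 + b\<^sup>2, -2 * a, 1:] A x) x = inner (A x - a *\<^sub>R x) (A x - a *\<^sub>R x) + b\<^sup>2 * inner x x"
    using op_symmetricD[OF sym, of "A x" x]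
    by (simp add: op_poly_pCons_apply blinfun.add_right blinfun.diff_right blinfun.scaleR_right inner_add_left
        inner_diff_right inner_diff_left inner_diff_right inner_commute power2_eq_square algebra_simps)
  then show "b\<^sup>2 * (norm x)\<^sup>2 \<le> inner (op_poly [:a\<^sup>2 + b\<^sup>2, -2 * a, 1:] A x) x"
    by (simp add: power2_norm_eq_inner)
qed

text \<open>
  The half of the spectral mapping theorem that is needed: factor \<open>q\<close> over the reals. Linear
  factors are invertible at \<open>A\<close> because their roots lie outside the spectrum, quadratic ones always.
\<close>

lemma op_poly_invertible:
  assumes sym: "op_symmetric A" and "q \<noteq> 0" and "\<And>t. t \<in> real_spectrum A \<Longrightarrow> poly q t \<noteq> 0"
  shows "op_invertible (op_poly q A)"
  using assms(2,3)
proof (induction "degree q" arbitrary: q rule: less_induct)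
  case less
  show ?case
  proof (cases "degree q = 0")
    case True
    then obtain c where "q = [:c:]" by (rule degree_eq_zeroE)
    then show ?thesis
      using less.prems by (simp add: op_poly_const op_invertible_scaleR op_invertible_id)
  next
    case False
    have step: ?thesis if d: "d dvd q" "degree d > 0" "op_invertible (op_poly d A)" for d
    proof -
      obtain p where p: "q = d * p" using d(1) by (auto elim: dvdE)
      have "degree p < degree q" "p \<noteq> 0" using p d(2) less.prems(1) by (auto simp: degree_mult_eq)
      moreover have "poly p t \<noteq> 0" if "t \<in> real_spectrum A" for t
        using less.prems(2)[OF that] p by auto
      ultimately have "op_invertible (op_poly p A)" using less.hyps by blast
      then show ?thesis using d(3) by (simp add: p op_poly_mult op_invertible_compose)
    qed
    consider t where "[:-t, 1:] dvd q" | a b where "b \<noteq> 0" "[:a\<^sup>2 + b\<^sup>2, -2 * a, 1:] dvd q"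
      using real_poly_has_factor[of q] False by blast
    then show ?thesis
    proof cases
      case 1
      then have "t \<notin> real_spectrum A" using less.prems(2) by (auto simp: poly_eq_0_iff_dvd)
      then have "op_invertible (op_poly [:-t, 1:] A)" by (simp add: real_spectrum_iff op_poly_linear)
      then show ?thesis using 1 step by simp
    next
      case 2
      then show ?thesis using step op_poly_quadratic_invertible[OF sym] by force
    qed
  qed
qed

text \<open>
  The infimum \<open>c\<close> of the quadratic form of \<open>q(A)\<close> on the unit sphere is a value of \<open>q\<close> on the
  spectrum: \<open>q(A) - c\<close> is positive but not coercive, hence not invertible. Requiring positive degree
  keeps \<open>q - c\<close> from being the zero polynomial; with \<open>q(t) = t\<close> this shows that the spectrum is
  nonempty.
\<close>

lemma op_poly_attains_lower_bound:
  assumes sym: "op_symmetric A" and deg: "degree q > 0" and "x \<noteq> 0"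
  shows "\<exists>t\<in>real_spectrum A. poly q t * (norm x)\<^sup>2 \<le> inner (op_poly q A x) x"
proof -
  define T where "T = op_poly q A"
  define V where "V = (\<lambda>y. inner (T y) y) ` {y. norm y = 1}"
  define c where "c = Inf V"
  have bdd: "bdd_below V"
  proof (rule bdd_belowI)
    fix v assume "v \<in> V"
    then obtain y where y: "norm y = 1" "v = inner (T y) y" by (auto simp: V_def)
    have "\<bar>inner (T y) y\<bar> \<le> norm (T y) * norm y" by (rule Cauchy_Schwarz_ineq2)
    also have "\<dots> \<le> norm T" using norm_blinfun[of T y] y by simp
    finally show "- norm T \<le> v" using y by simp
  qed
  have V: "inner (T y) y / (norm y)\<^sup>2 \<in> V" if "y \<noteq> 0" for y
    unfolding V_def using that
    by (intro image_eqI[of _ _ "y /\<^sub>R norm y"])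
      (auto simp: blinfun.scaleR_right power2_eq_square divide_simps)
  have le: "c * (norm y)\<^sup>2 \<le> inner (T y) y" for y
  proof (cases "y = 0")
    case False
    then have "c \<le> inner (T y) y / (norm y)\<^sup>2"
      unfolding c_def using bdd V by (intro cInf_lower) auto
    then show ?thesis using False by (simp add: pos_le_divide_eq)
  qed simp
  have diff: "inner (op_poly (q - [:c:]) A y) y = inner (T y) y - c * (norm y)\<^sup>2" for y
    by (simp add: op_poly_diff op_poly_const T_def blinfun.diff_left blinfun.scaleR_left
        inner_diff_left power2_norm_eq_inner)
  have "\<not> op_invertible (op_poly (q - [:c:]) A)"
  proof
    assume inv: "op_invertible (op_poly (q - [:c:]) A)"
    obtain d where d: "d > 0" "\<And>y. d * (norm y)\<^sup>2 \<le> inner (op_poly (q - [:c:]) A y) y"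
      using positive_invertible_coercive[OF op_symmetric_poly[OF sym] _ inv] le
      by (auto simp: diff)
    have "c + d \<le> Inf V"
    proof (rule cInf_greatest)
      show "V \<noteq> {}" using V[OF \<open>x \<noteq> 0\<close>] by auto
      fix v assume "v \<in> V"
      then obtain y where y: "norm y = 1" "v = inner (T y) y" by (auto simp: V_def)
      show "c + d \<le> v" using d(2)[of y] y by (simp add: diff)
    qed
    then show False using d(1) by (simp add: c_def)
  qed
  moreover have "q - [:c:] \<noteq> 0" using deg by auto
  ultimately obtain t where "t \<in> real_spectrum A" "poly q t = c"
    using op_poly_invertible[OF sym, of "q - [:c:]"] by auto
  then show ?thesis using le[of x] unfolding T_def by blast
qed

lemma op_poly_nonneg:
  assumes sym: "op_symmetric A" and pos: "\<And>t. t \<in> real_spectrum A \<Longrightarrow> 0 \<le> poly q t"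
  shows "0 \<le> inner (op_poly q A x) x"
proof (cases "x = 0")
  case x: False
  show ?thesis
  proof (cases "degree q = 0")
    case True
    then obtain c where q: "q = [:c:]" by (rule degree_eq_zeroE)
    \<comment> \<open>The constant is read off at any point of the spectrum, which is nonempty.\<close>
    obtain t where "t \<in> real_spectrum A"
      using op_poly_attains_lower_bound[OF sym, of "[:0, 1:]" x] x by auto
    then have "0 \<le> c" using pos q by fastforce
    then show ?thesis by (simp add: q op_poly_const blinfun.scaleR_left)
  next
    case False
    then obtain t where "t \<in> real_spectrum A" "poly q t * (norm x)\<^sup>2 \<le> inner (op_poly q A x) x"
      using op_poly_attains_lower_bound[OF sym _ x] by blast
    then show ?thesis using pos by (meson mult_nonneg_nonneg order_trans zero_le_power2)
  qed
qed simp

text \<open>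
  Positivity of \<open>e\<^sup>2 - q(A)\<^sup>2\<close> is a norm bound because \<open>q(A)\<close> is symmetric; so uniformly
  convergent polynomials on the spectrum give norm-convergent operators.
\<close>

lemma op_poly_norm_le:
  assumes sym: "op_symmetric A" and e: "0 \<le> e" "\<And>t. t \<in> real_spectrum A \<Longrightarrow> \<bar>poly q t\<bar> \<le> e"
  shows "norm (op_poly q A) \<le> e"
proof (rule norm_blinfun_bound[OF e(1)])
  fix x
  have "0 \<le> inner (op_poly ([:e\<^sup>2:] - q * q) A x) x"
  proof (rule op_poly_nonneg[OF sym])
    fix t assume "t \<in> real_spectrum A"
    then have "(poly q t)\<^sup>2 \<le> e\<^sup>2" using e(2) by (intro power2_le_iff_abs_le[OF e(1), THEN iffD2])
    then show "0 \<le> poly ([:e\<^sup>2:] - q * q) t" by (simp add: power2_eq_square)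
  qed
  also have "\<dots> = (e * norm x)\<^sup>2 - (norm (op_poly q A x))\<^sup>2"
    using op_symmetricD[OF op_symmetric_poly[OF sym], of q "op_poly q A x" x]
    by (simp add: op_poly_diff op_poly_const op_poly_mult_apply blinfun.diff_left blinfun.scaleR_left
        inner_diff_left power2_norm_eq_inner power_mult_distrib)
  finally have "(norm (op_poly q A x))\<^sup>2 \<le> (e * norm x)\<^sup>2" by linarith
  then show "norm (op_poly q A x) \<le> e * norm x"
    by (rule power2_le_imp_le) (simp add: e(1))
qed

section \<open>Continuous functional calculus\<close>

lemma polynomial_uniform_approximation:
  fixes f :: "real \<Rightarrow> real"
  assumes "continuous_on {a..b} f"
  shows "\<exists>p :: nat \<Rightarrow> real poly. uniform_limit {a..b} (\<lambda>n. poly (p n)) f sequentially"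
proof -
  have ex: "\<exists>p. \<forall>t\<in>{a..b}. \<bar>f t - poly p t\<bar> < e" if e: "0 < e" for e :: real
  proof -
    obtain g where g: "real_polynomial_function g" "\<And>t. t \<in> {a..b} \<Longrightarrow> \<bar>f t - g t\<bar> < e"
      using Stone_Weierstrass_real_polynomial_function[OF compact_Icc assms e] by blast
    then obtain c n where c: "g = (\<lambda>t. \<Sum>i\<le>n. c i * t ^ i)"
      by (auto simp: real_polynomial_function_iff_sum)
    have "poly (\<Sum>i\<le>n. monom (c i) i) t = g t" for t
      by (simp add: c poly_sum poly_monom)
    with g(2) show ?thesis by metis
  qed
  have "\<forall>n. \<exists>p. \<forall>t\<in>{a..b}. \<bar>f t - poly p t\<bar> < 1 / real (Suc n)"
    by (intro allI ex) simp
  then obtain p where p: "\<And>n t. t \<in> {a..b} \<Longrightarrow> \<bar>f t - poly (p n) t\<bar> < 1 / real (Suc n)"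
    by metis
  have "uniform_limit {a..b} (\<lambda>n. poly (p n)) f sequentially"
  proof (rule uniform_limitI)
    fix e :: real assume "0 < e"
    then have "\<forall>\<^sub>F n in sequentially. 1 / real (Suc n) < e"
      using LIMSEQ_inverse_real_of_nat[THEN order_tendstoD(2)] by (simp add: inverse_eq_divide)
    then show "\<forall>\<^sub>F n in sequentially. \<forall>t\<in>{a..b}. dist (poly (p n) t) (f t) < e"
      by eventually_elim (use p in \<open>force simp: dist_real_def abs_minus_commute intro: less_trans\<close>)
  qed
  then show ?thesis by blast
qed

lemma real_spectrum_subset:
  fixes A :: "'a::complex_hilbert \<Rightarrow>\<^sub>L 'a"
  assumes "\<And>x. a * (norm x)\<^sup>2 \<le> inner (A x) x" "\<And>x. inner (A x) x \<le> b * (norm x)\<^sup>2"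
  shows "real_spectrum A \<subseteq> {a..b}"
proof
  fix t assume t: "t \<in> real_spectrum A"
  have "op_invertible (A - t *\<^sub>R id_blinfun)" if "t < a"
    by (rule coercive_invertible[of "a - t"])
      (use assms(1) that in \<open>auto simp: blinfun.diff_left blinfun.scaleR_left inner_diff_left
        power2_norm_eq_inner algebra_simps\<close>)
  moreover have "op_invertible (A - t *\<^sub>R id_blinfun)" if "b < t"
  proof -
    have "op_invertible (t *\<^sub>R id_blinfun - A)"
      by (rule coercive_invertible[of "t - b"])
        (use assms(2) that in \<open>auto simp: blinfun.diff_left blinfun.scaleR_left inner_diff_left
          power2_norm_eq_inner algebra_simps\<close>)
    then have "op_invertible ((-1) *\<^sub>R (t *\<^sub>R id_blinfun - A))"
      by (rule op_invertible_scaleR) simp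
    then show ?thesis by simp
  qed
  ultimately show "t \<in> {a..b}" using t by (force simp: real_spectrum_iff)
qed

lemma op_poly_diff_tendsto:
  assumes sym: "op_symmetric A"
    and p: "uniform_limit (real_spectrum A) (\<lambda>n. poly (p n)) f sequentially"
    and q: "uniform_limit (real_spectrum A) (\<lambda>n. poly (q n)) f sequentially"
    and e: "e > 0"
  shows "\<exists>N. \<forall>n\<ge>N. \<forall>k\<ge>N. norm (op_poly (p n) A - op_poly (q k) A) \<le> e"
proof -
  have "e / 2 > 0" using e by simp
  then obtain N where N:
    "\<And>n t. n \<ge> N \<Longrightarrow> t \<in> real_spectrum A \<Longrightarrow> dist (poly (p n) t) (f t) < e / 2"
    "\<And>n t. n \<ge> N \<Longrightarrow> t \<in> real_spectrum A \<Longrightarrow> dist (poly (q n) t) (f t) < e / 2"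
    using eventually_conj[OF uniform_limitD[OF p] uniform_limitD[OF q]]
    unfolding eventually_sequentially by (metis (no_types, lifting))
  have "norm (op_poly (p n) A - op_poly (q k) A) \<le> e" if nk: "n \<ge> N" "k \<ge> N" for n k
    unfolding op_poly_diff[symmetric]
  proof (rule op_poly_norm_le[OF sym])
    fix t assume t: "t \<in> real_spectrum A"
    show "\<bar>poly (p n - q k) t\<bar> \<le> e"
      using N(1)[OF nk(1) t] N(2)[OF nk(2) t] by (simp add: dist_real_def abs_if split: if_splits)
  qed (use e in simp)
  then show ?thesis by blast
qed

text \<open>
  The definite description in \<open>fun_calc\<close> is meaningful: all approximating sequences of polynomials
  give the same limit by \<open>op_poly_norm_le\<close>, and at least one exists by Weierstrass.
\<close>

lemma fun_calc_limit:
  assumes sym: "op_symmetric A" and spec: "real_spectrum A \<subseteq> {a..b}" and f: "continuous_on {a..b} f"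
    and p: "uniform_limit (real_spectrum A) (\<lambda>n. poly (p n)) f sequentially"
  shows "(\<lambda>n. op_poly (p n) A) \<longlonglongrightarrow> fun_calc f A"
proof -
  let ?approx = "\<lambda>p. uniform_limit (real_spectrum A) (\<lambda>n. poly (p n)) f sequentially"
  obtain p0 where p0: "?approx p0"
    using polynomial_uniform_approximation[OF f] uniform_limit_on_subset[OF _ spec] by blast
  have "Cauchy (\<lambda>n. op_poly (p0 n) A)"
    unfolding Cauchy_def dist_norm
  proof (intro allI impI)
    fix e :: real assume "0 < e"
    then obtain N where "\<And>n k. n \<ge> N \<Longrightarrow> k \<ge> N \<Longrightarrow> norm (op_poly (p0 n) A - op_poly (p0 k) A) \<le> e / 2"
      using op_poly_diff_tendsto[OF sym p0 p0, of "e / 2"] by auto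
    then show "\<exists>N. \<forall>m\<ge>N. \<forall>n\<ge>N. norm (op_poly (p0 m) A - op_poly (p0 n) A) < e"
      using \<open>0 < e\<close> by (intro exI[of _ N]) fastforce
  qed
  then obtain B where B: "(\<lambda>n. op_poly (p0 n) A) \<longlonglongrightarrow> B"
    using Cauchy_convergent convergent_def by blast
  have all: "(\<lambda>n. op_poly (p n) A) \<longlonglongrightarrow> B" if appr: "?approx p" for p
  proof -
    have "(\<lambda>n. op_poly (p n) A - op_poly (p0 n) A) \<longlonglongrightarrow> 0"
    proof (rule LIMSEQ_I)
      fix e :: real assume "0 < e"
      then obtain N where "\<And>n k. n \<ge> N \<Longrightarrow> k \<ge> N \<Longrightarrow> norm (op_poly (p n) A - op_poly (p0 k) A) \<le> e / 2"
        using op_poly_diff_tendsto[OF sym appr p0, of "e / 2"] by auto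
      then show "\<exists>N. \<forall>n\<ge>N. norm (op_poly (p n) A - op_poly (p0 n) A - 0) < e"
        using \<open>0 < e\<close> by (intro exI[of _ N]) fastforce
    qed
    from tendsto_add[OF this B] show ?thesis by simp
  qed
  have "fun_calc f A = B"
    unfolding fun_calc_def real_spectrum_def[symmetric]
    by (rule the_equality) (use all p0 B LIMSEQ_unique in blast)+
  then show ?thesis using all[OF p] by simp
qed

lemma fun_calc_poly:
  assumes sym: "op_symmetric A" and spec: "real_spectrum A \<subseteq> {a..b}"
  shows "fun_calc (poly q) A = op_poly q A"
proof -
  have "(\<lambda>n. op_poly q A) \<longlonglongrightarrow> fun_calc (poly q) A"
    by (rule fun_calc_limit[OF sym spec]) (auto intro!: continuous_intros uniform_limitI)
  then show ?thesis by (simp add: LIMSEQ_const_iff)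
qed

text \<open>
  Polynomials close to \<open>f\<close> and \<open>g\<close> satisfy \<open>f \<le> g\<close> up to an additive constant \<open>d\<close>, which tends to 0;
  positivity of \<open>q n - p n + d\<close> on the spectrum then passes to the limit.
\<close>

lemma fun_calc_mono:
  assumes sym: "op_symmetric A" and spec: "real_spectrum A \<subseteq> {a..b}"
    and f: "continuous_on {a..b} f" and g: "continuous_on {a..b} g"
    and le: "\<And>t. t \<in> {a..b} \<Longrightarrow> f t \<le> g t"
  shows "inner (fun_calc f A x) x \<le> inner (fun_calc g A x) x"
proof -
  obtain p q where p: "uniform_limit (real_spectrum A) (\<lambda>n. poly (p n)) f sequentially"
    and q: "uniform_limit (real_spectrum A) (\<lambda>n. poly (q n)) g sequentially"
    using polynomial_uniform_approximation[OF f] polynomial_uniform_approximation[OF g]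
      uniform_limit_on_subset[OF _ spec] by blast
  have lim: "(\<lambda>n. inner (op_poly (r n) A x) x) \<longlonglongrightarrow> inner (fun_calc h A x) x"
    if "uniform_limit (real_spectrum A) (\<lambda>n. poly (r n)) h sequentially" "continuous_on {a..b} h"
    for r h
    by (intro tendsto_intros fun_calc_limit[OF sym spec that(2,1)])
  show ?thesis
  proof (rule field_le_epsilon)
    fix e :: real assume e: "0 < e"
    define d where "d = e / ((norm x)\<^sup>2 + 1)"
    have d: "d > 0" "d * (norm x)\<^sup>2 \<le> e"
      unfolding d_def using e add_nonneg_pos[of "(norm x)\<^sup>2" 1] by (auto simp: field_simps)
    have "\<forall>\<^sub>F n in sequentially. inner (op_poly (p n) A x) x \<le> inner (op_poly (q n) A x) x + e"
      using uniform_limitD[OF p half_gt_zero[OF d(1)]] uniform_limitD[OF q half_gt_zero[OF d(1)]]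
    proof eventually_elim
      case (elim n)
      have "0 \<le> inner (op_poly (q n - p n + [:d:]) A x) x"
      proof (rule op_poly_nonneg[OF sym])
        fix t assume t: "t \<in> real_spectrum A"
        then have "\<bar>poly (p n) t - f t\<bar> < d / 2" "\<bar>poly (q n) t - g t\<bar> < d / 2"
          using elim d(1) by (auto simp: dist_real_def)
        moreover have "f t \<le> g t" using le spec t by blast
        ultimately show "0 \<le> poly (q n - p n + [:d:]) t" by (simp add: abs_if split: if_splits)
      qed
      also have "\<dots> = inner (op_poly (q n) A x) x - inner (op_poly (p n) A x) x + d * (norm x)\<^sup>2"
        by (simp add: op_poly_add op_poly_diff op_poly_const blinfun.add_left blinfun.diff_left
            blinfun.scaleR_left inner_add_left inner_diff_left power2_norm_eq_inner)
      finally show ?case using d(2) by linarith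
    qed
    then show "inner (fun_calc f A x) x \<le> inner (fun_calc g A x) x + e"
      by (rule tendsto_le[OF sequentially_bot tendsto_add[OF lim[OF q g] tendsto_const] lim[OF p f]])
  qed
qed

lemma op_symmetric_shift:
  assumes "op_symmetric A" shows "op_symmetric (A + e *\<^sub>R id_blinfun)"
  using op_symmetric_poly[OF assms, of "[:e, 1:]"] by (simp add: op_poly_linear add.commute)

lemma real_spectrum_shift:
  fixes A :: "'a::complex_hilbert \<Rightarrow>\<^sub>L 'a"
  shows "t \<in> real_spectrum (A + e *\<^sub>R id_blinfun) \<longleftrightarrow> t - e \<in> real_spectrum A"
  by (simp add: real_spectrum_iff algebra_simps)

lemma fun_calc_shift:
  assumes sym: "op_symmetric A" and spec: "real_spectrum A \<subseteq> {a..b}"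
    and f: "continuous_on {a + e..b + e} f"
  shows "fun_calc f (A + e *\<^sub>R id_blinfun) = fun_calc (\<lambda>t. f (t + e)) A"
proof -
  have spec': "real_spectrum (A + e *\<^sub>R id_blinfun) \<subseteq> {a + e..b + e}"
    using spec by (force simp: real_spectrum_shift)
  have f': "continuous_on {a..b} (\<lambda>t. f (t + e))"
    by (rule continuous_on_compose2[OF f]) (auto intro!: continuous_intros)
  obtain p where p: "uniform_limit {a + e..b + e} (\<lambda>n. poly (p n)) f sequentially"
    using polynomial_uniform_approximation[OF f] by blast
  have "uniform_limit (real_spectrum A) (\<lambda>n. poly (pcompose (p n) [:e, 1:])) (\<lambda>t. f (t + e)) sequentially"
  proof (rule uniform_limitI)
    fix d :: real assume "0 < d"
    from uniform_limitD[OF p this]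
    show "\<forall>\<^sub>F n in sequentially. \<forall>t\<in>real_spectrum A. dist (poly (pcompose (p n) [:e, 1:]) t) (f (t + e)) < d"
      by eventually_elim (use spec in \<open>force simp: poly_pcompose add.commute\<close>)
  qed
  then have "(\<lambda>n. op_poly (pcompose (p n) [:e, 1:]) A) \<longlonglongrightarrow> fun_calc (\<lambda>t. f (t + e)) A"
    by (rule fun_calc_limit[OF sym spec f'])
  moreover have "op_poly (pcompose (p n) [:e, 1:]) A = op_poly (p n) (A + e *\<^sub>R id_blinfun)" for n
    by (simp add: op_poly_pcompose op_poly_linear add.commute)
  moreover have "(\<lambda>n. op_poly (p n) (A + e *\<^sub>R id_blinfun)) \<longlonglongrightarrow> fun_calc f (A + e *\<^sub>R id_blinfun)"
    by (rule fun_calc_limit[OF op_symmetric_shift[OF sym] spec' f uniform_limit_on_subset[OF p spec']])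
  ultimately show ?thesis using LIMSEQ_unique by simp
qed

section \<open>Bounds for the logarithm and the determinant\<close>

lemma positive_spectrum:
  fixes A :: "'a::complex_hilbert \<Rightarrow>\<^sub>L 'a"
  assumes "\<And>x. 0 \<le> inner (A x) x"
  shows "real_spectrum A \<subseteq> {0..norm A}"
proof (rule real_spectrum_subset)
  show "0 * (norm x)\<^sup>2 \<le> inner (A x) x" for x using assms by simp
  have "inner (A x) x \<le> norm (A x) * norm x" for x by (rule norm_cauchy_schwarz)
  also have "norm (A x) * norm x \<le> norm A * norm x * norm x" for x
    by (intro mult_right_mono norm_blinfun) simp
  finally show "inner (A x) x \<le> norm A * (norm x)\<^sup>2" for x
    by (simp add: power2_eq_square mult.assoc)
qed

lemma op_log_shift:
  assumes sym: "op_symmetric A" and spec: "real_spectrum A \<subseteq> {a..b}" and e: "0 < a + e"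
  shows "op_log (A + e *\<^sub>R id_blinfun) = fun_calc (\<lambda>t. ln (t + e)) A"
  unfolding op_log_def using e
  by (intro fun_calc_shift[OF sym spec]) (auto intro!: continuous_intros)

lemma op_log_shift_mono:
  assumes sym: "op_symmetric A" and spec: "real_spectrum A \<subseteq> {a..b}"
    and "0 < a + d" "d \<le> e"
  shows "inner (op_log (A + d *\<^sub>R id_blinfun) x) x \<le> inner (op_log (A + e *\<^sub>R id_blinfun) x) x"
proof -
  have "0 < a + e" using assms(3,4) by simp
  then show ?thesis
    using assms(3,4)
    by (simp add: op_log_shift[OF sym spec])
      (rule fun_calc_mono[OF sym spec]; force intro!: continuous_intros)
qed

lemma op_log_shift_ge_affine:
  assumes sym: "op_symmetric A" and spec: "real_spectrum A \<subseteq> {a..b}" and e: "0 < a + e"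
    and le: "\<And>t. t \<in> {a..b} \<Longrightarrow> \<alpha> + \<beta> * t \<le> ln (t + e)" and x: "norm x = 1"
  shows "\<alpha> + \<beta> * inner (A x) x \<le> inner (op_log (A + e *\<^sub>R id_blinfun) x) x"
proof -
  have "inner (fun_calc (poly [:\<alpha>, \<beta>:]) A x) x \<le> inner (fun_calc (\<lambda>t. ln (t + e)) A x) x"
    by (rule fun_calc_mono[OF sym spec])
      (use e le in \<open>auto intro!: continuous_intros simp: mult.commute\<close>)
  then show ?thesis
    using x dot_square_norm[of x]
    by (simp add: fun_calc_poly[OF sym spec] op_poly_linear op_log_shift[OF sym spec e]
        blinfun.add_left blinfun.scaleR_left inner_add_left)
qed

lemma op_log_shift_le_affine:
  assumes sym: "op_symmetric A" and spec: "real_spectrum A \<subseteq> {a..b}" and e: "0 < a + e"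
    and le: "\<And>t. t \<in> {a..b} \<Longrightarrow> ln (t + e) \<le> \<alpha> + \<beta> * t" and x: "norm x = 1"
  shows "inner (op_log (A + e *\<^sub>R id_blinfun) x) x \<le> \<alpha> + \<beta> * inner (A x) x"
proof -
  have "inner (fun_calc (\<lambda>t. ln (t + e)) A x) x \<le> inner (fun_calc (poly [:\<alpha>, \<beta>:]) A x) x"
    by (rule fun_calc_mono[OF sym spec])
      (use e le in \<open>auto intro!: continuous_intros simp: mult.commute\<close>)
  then show ?thesis
    using x dot_square_norm[of x]
    by (simp add: fun_calc_poly[OF sym spec] op_poly_linear op_log_shift[OF sym spec e]
        blinfun.add_left blinfun.scaleR_left inner_add_left)
qed

text \<open>
  Jensen's inequality for the concave function \<open>ln\<close> and the spectral distribution of \<open>A + e I\<close> at \<open>x\<close>.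
\<close>

lemma op_log_jensen:
  assumes sym: "op_symmetric A" and pos: "\<And>y. 0 \<le> inner (A y) y" and e: "0 < e" and x: "norm x = 1"
  shows "inner (op_log (A + e *\<^sub>R id_blinfun) x) x \<le> ln (inner (A x) x + e)"
proof -
  define c where "c = inner (A x) x + e"
  have c: "c > 0" using pos[of x] e by (simp add: c_def)
  \<comment> \<open>The tangent line of the concave function \<open>ln\<close> at the mean value \<open>c\<close>.\<close>
  have "inner (op_log (A + e *\<^sub>R id_blinfun) x) x \<le> (ln c - 1 + e / c) + (1 / c) * inner (A x) x"
  proof (rule op_log_shift_le_affine[OF sym positive_spectrum[OF pos] _ _ x])
    fix t assume t: "t \<in> {0..norm A}"
    then have te: "t + e > 0" using e by simp
    then have "ln ((t + e) / c) \<le> (t + e) / c - 1" using c by (intro ln_le_minus_one) simp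
    then show "ln (t + e) \<le> (ln c - 1 + e / c) + (1 / c) * t"
      using ln_div[of "t + e" c] te c by (simp add: add_divide_distrib)
  qed (use e in simp)
  also have "\<dots> = ln c"
  proof -
    have "e / c + inner (A x) x / c = 1"
      using c by (simp add: c_def add_divide_distrib[symmetric] add.commute)
    then show ?thesis by simp
  qed
  finally show ?thesis by (simp add: c_def)
qed

lemma exp_ereal_ereal [simp]: "exp_ereal (ereal r) = ereal (exp r)"
  by (simp add: exp_ereal_def)

lemma exp_ereal_mono: "a \<le> b \<Longrightarrow> exp_ereal a \<le> exp_ereal b"
  by (cases a; cases b) (auto simp: exp_ereal_def)

text \<open>
  The limit in the definition exists, possibly as \<open>- \<infinity>\<close>, because \<open>\<langle>log (A + e I) x, x\<rangle>\<close> is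
  monotone in \<open>e\<close>; hence it is an infimum, which is convenient for bounds in both directions.
\<close>

lemma fs_det_eq_INF:
  assumes sym: "op_symmetric A" and pos: "\<And>y. 0 \<le> inner (A y) y"
  shows "fs_det x A = exp_ereal (INF e\<in>{0<..}. ereal (inner (op_log (A + e *\<^sub>R id_blinfun) x) x))"
proof -
  let ?F = "\<lambda>e. ereal (inner (op_log (A + e *\<^sub>R id_blinfun) x) x)"
  have mono: "?F d \<le> ?F e" if "0 < d" "d \<le> e" for d e
    using op_log_shift_mono[OF sym positive_spectrum[OF pos], of d e x] that by simp
  have "(?F \<longlongrightarrow> (INF e\<in>{0<..}. ?F e)) (at_right 0)"
  proof (rule order_tendstoI)
    fix l assume "l < (INF e\<in>{0<..}. ?F e)"
    then have "l < ?F e" if "0 < e" for e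
      using that by (meson INF_lower greaterThan_iff less_le_trans)
    then show "\<forall>\<^sub>F e in at_right 0. l < ?F e"
      by (auto simp: eventually_at_filter)
  next
    fix l assume "(INF e\<in>{0<..}. ?F e) < l"
    then obtain d where d: "0 < d" "?F d < l" by (auto simp: INF_less_iff)
    have "\<forall>\<^sub>F e in at_right 0. e \<in> {0<..<d}" using d(1) by (rule eventually_at_right_real)
    then show "\<forall>\<^sub>F e in at_right 0. ?F e < l"
    proof eventually_elim
      case (elim e)
      then have "?F e \<le> ?F d" by (intro mono) auto
      then show ?case using d(2) by (rule le_less_trans)
    qed
  qed
  then show ?thesis
    unfolding fs_det_def inner_eq_Re_cinner[symmetric]
    by (simp add: tendsto_Lim)
qed

lemma fs_det_le_inner:
  assumes sym: "op_symmetric A" and pos: "\<And>y. 0 \<le> inner (A y) y" and x: "norm x = 1"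
  shows "fs_det x A \<le> ereal (inner (A x) x)"
proof (rule ereal_le_epsilon2)
  fix e :: real assume e: "0 < e"
  have "(INF e\<in>{0<..}. ereal (inner (op_log (A + e *\<^sub>R id_blinfun) x) x)) \<le> ereal (ln (inner (A x) x + e))"
    by (rule INF_lower2[of e]) (use e op_log_jensen[OF sym pos e x] in auto)
  then have "fs_det x A \<le> exp_ereal (ereal (ln (inner (A x) x + e)))"
    unfolding fs_det_eq_INF[OF sym pos] by (rule exp_ereal_mono)
  then show "fs_det x A \<le> ereal (inner (A x) x) + ereal e"
    using pos[of x] e by simp
qed

lemma exp_affine_le_fs_det:
  assumes sym: "op_symmetric B" and m: "0 < m"
    and lower: "\<And>y. m * (norm y)\<^sup>2 \<le> inner (B y) y"
    and upper: "\<And>y. inner (B y) y \<le> M * (norm y)\<^sup>2"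
    and le: "\<And>t. t \<in> {m..M} \<Longrightarrow> \<alpha> + \<beta> * t \<le> ln t" and x: "norm x = 1"
  shows "ereal (exp (\<alpha> + \<beta> * inner (B x) x)) \<le> fs_det x B"
proof -
  have pos: "0 \<le> inner (B y) y" for y
    using lower[of y] m by (meson less_imp_le mult_nonneg_nonneg order_trans zero_le_power2)
  have "ereal (\<alpha> + \<beta> * inner (B x) x)
      \<le> (INF e\<in>{0<..}. ereal (inner (op_log (B + e *\<^sub>R id_blinfun) x) x))"
  proof (rule INF_greatest)
    fix e :: real assume "e \<in> {0<..}"
    then have e: "0 < e" by simp
    have "\<alpha> + \<beta> * inner (B x) x \<le> inner (op_log (B + e *\<^sub>R id_blinfun) x) x"
    proof (rule op_log_shift_ge_affine[OF sym real_spectrum_subset[OF lower upper] _ _ x])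
      fix t assume t: "t \<in> {m..M}"
      then have "ln t \<le> ln (t + e)" using m e by simp
      with le[OF t] show "\<alpha> + \<beta> * t \<le> ln (t + e)" by simp
    qed (use m e in simp)
    then show "ereal (\<alpha> + \<beta> * inner (B x) x) \<le> ereal (inner (op_log (B + e *\<^sub>R id_blinfun) x) x)"
      by simp
  qed
  then show ?thesis
    unfolding fs_det_eq_INF[OF sym pos] using exp_ereal_mono by fastforce
qed

text \<open>
  \<open>L\<close> is the logarithmic mean of \<open>m\<close> and \<open>M\<close>, the reciprocal of the slope of the chord of \<open>ln\<close>.
\<close>

lemma specht_const_eq:
  assumes "0 < m" "m < M"
  defines "L \<equiv> (M - m) / (ln M - ln m)"
  shows "specht_const m M = L * (ln L - ln m + m / L - 1)"
proof -
  have h: "M / m > 1" "ln M - ln m > 0" "M - m > 0" using assms by auto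
  have lh: "ln (M / m) = ln M - ln m" using assms by (simp add: ln_div)
  have e: "M / m - 1 = (M - m) / m" using assms by (simp add: field_simps)
  have "ln (specht (M / m)) = ln (M / m - 1) + ln ((M / m) powr (1 / (M / m - 1))) - (1 + ln (ln (M / m)))"
    using h assms(1,2) by (simp add: specht_def ln_div ln_mult lh)
  also have "\<dots> = (ln (M - m) - ln m) + (ln M - ln m) / (M - m) * m - (1 + ln (ln M - ln m))"
    using assms h by (simp add: ln_powr lh e ln_div)
  also have "\<dots> = ln L - ln m + m / L - 1"
    using assms h by (simp add: L_def ln_div)
  finally show ?thesis using assms by (simp add: specht_const_def L_def)
qed

text \<open>
  Here \<open>\<alpha> + \<beta> t\<close> is the chord of \<open>ln\<close> over \<open>[m, M]\<close>, a lower bound by concavity, and the Specht constant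
  is the maximum of \<open>s - exp (\<alpha> + \<beta> s)\<close>. For \<open>m = M\<close> the chord degenerates to the constant \<open>ln m\<close>.
\<close>

lemma specht_const_chord_bound:
  assumes m: "0 < m" and mM: "m \<le> M"
  obtains \<alpha> \<beta> where "\<And>t. t \<in> {m..M} \<Longrightarrow> \<alpha> + \<beta> * t \<le> ln t"
    and "\<And>s. s \<in> {m..M} \<Longrightarrow> s - specht_const m M \<le> exp (\<alpha> + \<beta> * s)"
proof (cases "m < M")
  case True
  define L where "L = (M - m) / (ln M - ln m)"
  define \<alpha> where "\<alpha> = ln m - m / L"
  have d: "ln M - ln m > 0" "M - m > 0" using m True by auto
  have L: "L > 0" using d by (simp add: L_def)
  have chord: "\<alpha> + (1 / L) * t \<le> ln t" if t: "t \<in> {m..M}" for t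
  proof -
    define w where "w = (t - m) / (M - m)"
    have w: "0 \<le> w" "w \<le> 1" using t d by (auto simp: w_def)
    have wM: "w * (M - m) = t - m" using d by (simp add: w_def)
    then have tw: "t = (1 - w) * m + w * M" by (simp add: algebra_simps)
    have "(1 - w) * ln m + w * ln M \<le> ln ((1 - w) * m + w * M)"
      using concave_onD[OF ln_concave w, of m M] m True by simp
    moreover have "\<alpha> + (1 / L) * t = (1 - w) * ln m + w * ln M"
    proof -
      have "\<alpha> + (1 / L) * t = ln m + (t - m) / L" by (simp add: \<alpha>_def diff_divide_distrib)
      also have "\<dots> = ln m + w * (ln M - ln m)" by (simp add: w_def L_def)
      finally show ?thesis by (simp add: algebra_simps)
    qed
    ultimately show ?thesis using tw by simp
  qed
  have "s - specht_const m M \<le> exp (\<alpha> + (1 / L) * s)" for s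
  proof -
    \<comment> \<open>The exponential has slope 1 in \<open>s\<close> where its value is \<open>L\<close>; use the tangent there.\<close>
    have "1 + (\<alpha> + (1 / L) * s - ln L) \<le> exp (\<alpha> + (1 / L) * s - ln L)" by (rule exp_ge_add_one_self)
    also have "\<dots> = exp (\<alpha> + (1 / L) * s) / L" using L by (simp add: exp_diff)
    finally have "L * (1 + (\<alpha> + (1 / L) * s - ln L)) \<le> exp (\<alpha> + (1 / L) * s)"
      using L by (simp add: field_simps)
    moreover have "L * (1 + (\<alpha> + (1 / L) * s - ln L)) = s - specht_const m M"
      using L specht_const_eq[OF m True] by (simp add: \<alpha>_def L_def[symmetric] field_simps)
    ultimately show ?thesis by simp
  qed
  with chord that show ?thesis by blast
next
  case False
  with mM have "m = M" by simp
  then show ?thesis using m that[of "ln m" 0] by (simp add: specht_const_def)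
qed

text \<open>
  The reverse Jensen inequality for \<open>B\<close>, the comparison of determinants, and Jensen's inequality
  for \<open>A\<close>, scaled from unit vectors to all vectors.
\<close>

lemma fs_det_le_imp_inner_le:
  assumes A: "op_symmetric A" "\<And>y. 0 \<le> inner (A y) y"
    and B: "op_symmetric B" "\<And>y. m * (norm y)\<^sup>2 \<le> inner (B y) y" "\<And>y. inner (B y) y \<le> M * (norm y)\<^sup>2"
    and m: "0 < m" "m \<le> M"
    and det: "\<And>x. norm x = 1 \<Longrightarrow> fs_det x B \<le> fs_det x A"
  shows "inner (B y) y \<le> inner (A y) y + specht_const m M * (norm y)\<^sup>2"
proof (cases "y = 0")
  case False
  obtain \<alpha> \<beta> where ln: "\<And>t. t \<in> {m..M} \<Longrightarrow> \<alpha> + \<beta> * t \<le> ln t"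
    and exp: "\<And>s. s \<in> {m..M} \<Longrightarrow> s - specht_const m M \<le> exp (\<alpha> + \<beta> * s)"
    using specht_const_chord_bound[OF m] by metis
  have unit: "inner (B x) x - specht_const m M \<le> inner (A x) x" if x: "norm x = 1" for x
  proof -
    have "inner (B x) x - specht_const m M \<le> exp (\<alpha> + \<beta> * inner (B x) x)"
      using B(2,3)[of x] x by (intro exp) auto
    moreover have "ereal (exp (\<alpha> + \<beta> * inner (B x) x)) \<le> ereal (inner (A x) x)"
      using exp_affine_le_fs_det[OF B(1) m(1) B(2,3) ln x] det[OF x] fs_det_le_inner[OF A x]
      by (meson order_trans)
    ultimately show ?thesis by simp
  qed
  define x where "x = y /\<^sub>R norm y"
  have y: "y = norm y *\<^sub>R x" and "norm x = 1" using False by (auto simp: x_def)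
  have "inner (T y) y = (norm y)\<^sup>2 * inner (T x) x" for T :: "'a \<Rightarrow>\<^sub>L 'a"
    by (subst (1 2) y) (simp add: blinfun.scaleR_right power2_eq_square mult.assoc)
  then show ?thesis
    using mult_left_mono[OF unit[OF \<open>norm x = 1\<close>], of "(norm y)\<^sup>2"] by (simp add: algebra_simps)
qed simp

section \<open>Riesz representation\<close>

text \<open>
  The vector \<open>y\<close> is the minimiser of \<open>F x = \<parallel>x\<parallel>\<^sup>2 - 2 \<phi> x\<close>. By the parallelogram law
  minimising sequences of \<open>F\<close> are Cauchy, and stationarity of \<open>F\<close> at \<open>y\<close> is the representation.
\<close>

lemma riesz_representation:
  fixes \<phi> :: "'a::complex_hilbert \<Rightarrow>\<^sub>L real"
  shows "\<exists>y. \<forall>x. inner y x = \<phi> x"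
proof -
  define F where "F x = (norm x)\<^sup>2 - 2 * \<phi> x" for x
  have mid: "F x + F y - 2 * F ((1/2) *\<^sub>R (x + y)) = (norm (x - y))\<^sup>2 / 2" for x y
    by (simp add: F_def power2_norm_eq_inner blinfun.scaleR_right blinfun.add_right
        inner_add_left inner_add_right inner_diff_left inner_diff_right inner_commute algebra_simps)
  have bdd: "bdd_below (range F)"
  proof (rule bdd_belowI2)
    fix x
    have "2 * \<phi> x \<le> 2 * (norm \<phi> * norm x)" using norm_blinfun[of \<phi> x] by simp
    moreover have "0 \<le> (norm x - norm \<phi>)\<^sup>2" by simp
    ultimately show "- (norm \<phi>)\<^sup>2 \<le> F x"
      by (simp add: F_def power2_eq_square algebra_simps)
  qed
  define d where "d = Inf (range F)"
  have d: "d \<le> F x" for x unfolding d_def by (rule cInf_lower) (use bdd in auto)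
  have "\<exists>x. F x < d + inverse (real (Suc n))" for n
  proof -
    have "Inf (range F) < d + inverse (real (Suc n))" by (simp add: d_def)
    then show ?thesis by (subst (asm) cInf_less_iff) (use bdd in auto)
  qed
  then obtain X where X: "\<And>n. F (X n) < d + inverse (real (Suc n))" by metis
  have dist: "(norm (X k - X n))\<^sup>2 \<le> 4 * inverse (real (Suc N))" if "N \<le> k" "N \<le> n" for k n N
  proof -
    have "(norm (X k - X n))\<^sup>2 = 2 * (F (X k) + F (X n) - 2 * F ((1/2) *\<^sub>R (X k + X n)))"
      using mid[of "X k" "X n"] by simp
    also have "\<dots> \<le> 2 * (inverse (real (Suc k)) + inverse (real (Suc n)))"
      using X[of k] X[of n] d[of "(1/2) *\<^sub>R (X k + X n)"] by simp
    also have "\<dots> \<le> 2 * (inverse (real (Suc N)) + inverse (real (Suc N)))"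
      using that by (intro mult_left_mono add_mono le_imp_inverse_le) auto
    finally show ?thesis by simp
  qed
  have "Cauchy X"
    unfolding Cauchy_def dist_norm
  proof (intro allI impI)
    fix e :: real assume e: "0 < e"
    then have "0 < e\<^sup>2 / 4" by simp
    then obtain N where N: "inverse (real (Suc N)) < e\<^sup>2 / 4" using reals_Archimedean by blast
    have "norm (X k - X n) < e" if "N \<le> k" "N \<le> n" for k n
    proof (rule power_less_imp_less_base)
      show "(norm (X k - X n))\<^sup>2 < e\<^sup>2" using dist[OF that] N by linarith
    qed (use e in simp)
    then show "\<exists>N. \<forall>m\<ge>N. \<forall>n\<ge>N. norm (X m - X n) < e" by blast
  qed
  then obtain y where y: "X \<longlonglongrightarrow> y" using Cauchy_convergent convergent_def by blast
  have "(\<lambda>n. F (X n)) \<longlonglongrightarrow> F y" unfolding F_def by (intro tendsto_intros y)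
  moreover have "(\<lambda>n. d + inverse (real (Suc n))) \<longlonglongrightarrow> d + 0"
    by (intro tendsto_add tendsto_const LIMSEQ_inverse_real_of_nat)
  ultimately have "F y \<le> d + 0"
    by (rule LIMSEQ_le) (use X less_imp_le in blast)
  then have min: "F y \<le> F x" for x using d[of x] by simp
  have "inner y x = \<phi> x" for x
  proof -
    define c where "c = inner y x - \<phi> x"
    \<comment> \<open>The best step in direction \<open>x\<close> would be \<open>- c / \<parallel>x\<parallel>\<^sup>2\<close>; adding 1 covers \<open>x = 0\<close>.\<close>
    define t where "t = - c / ((norm x)\<^sup>2 + 1)"
    have pos: "(norm x)\<^sup>2 + 1 > 0" by (simp add: add_nonneg_pos)
    have "0 \<le> F (y + t *\<^sub>R x) - F y" using min[of "y + t *\<^sub>R x"] by simp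
    also have "\<dots> = 2 * t * c + t\<^sup>2 * (norm x)\<^sup>2"
      unfolding F_def power2_norm_eq_inner c_def
      by (simp add: blinfun.scaleR_right blinfun.add_right inner_add_left inner_add_right
          inner_commute power2_eq_square algebra_simps)
    also have "\<dots> \<le> 2 * t * c + t\<^sup>2 * ((norm x)\<^sup>2 + 1)"
      using mult_left_mono[of "(norm x)\<^sup>2" "(norm x)\<^sup>2 + 1" "t\<^sup>2"] by simp
    also have "\<dots> = - c\<^sup>2 / ((norm x)\<^sup>2 + 1)"
      using pos by (simp add: t_def power2_eq_square divide_simps) 
    finally have "c\<^sup>2 \<le> 0" using pos by (simp add: divide_le_0_iff)
    then show ?thesis by (simp add: c_def)
  qed
  then show ?thesis by blast
qed

lemma bounded_form_operator:
  fixes b :: "'a::complex_hilbert \<Rightarrow>\<^sub>L ('a \<Rightarrow>\<^sub>L real)"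
  obtains A :: "'a \<Rightarrow>\<^sub>L 'a" where "\<And>s t. inner (A s) t = b s t"
proof -
  obtain A where A: "\<And>s t. inner (A s) t = b s t"
    using riesz_representation[of "b s" for s] by metis
  have eq: "x = y" if "\<And>t. inner x t = inner y t" for x y :: 'a
    by (metis eq_iff_diff_eq_0 inner_diff_left inner_eq_zero_iff that)
  have "bounded_linear A"
  proof (rule bounded_linear_intro[where K = "norm b"])
    show "A (x + y) = A x + A y" for x y
      by (rule eq) (simp add: A inner_add_left blinfun.add_right blinfun.add_left)
    show "A (r *\<^sub>R x) = r *\<^sub>R A x" for r x
      by (rule eq) (simp add: A blinfun.scaleR_right blinfun.scaleR_left)
    show "norm (A x) \<le> norm x * norm b" for x
    proof (cases "A x = 0")
      case False
      have "norm (A x) * norm (A x) = b x (A x)"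
        using A[of x "A x"] by (simp add: dot_square_norm power2_eq_square)
      also have "\<dots> \<le> norm (b x) * norm (A x)" using norm_blinfun[of "b x" "A x"] by simp
      finally have "norm (A x) \<le> norm (b x)" using False by simp
      also have "\<dots> \<le> norm b * norm x" by (rule norm_blinfun)
      finally show ?thesis by (simp add: mult.commute)
    qed simp
  qed
  then show ?thesis using that[of "Blinfun A"] A by (simp add: bounded_linear_Blinfun_apply)
qed

section \<open>The Levi operator\<close>

lemma cinner_scaleC_right: "cinner x (scaleC a y) = cnj a * cinner x y"
  by (metis cinner_commute cinner_scaleC_left complex_cnj_mult)

lemma inner_scaleC_i: "inner (scaleC \<i> x) y = - inner x (scaleC \<i> y)"
  by (simp add: inner_eq_Re_cinner cinner_scaleC_left cinner_scaleC_right)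

lemma cinner_eq_Complex: "cinner x y = Complex (inner x y) (inner x (scaleC \<i> y))"
  by (simp add: inner_eq_Re_cinner cinner_scaleC_right complex_eq_iff)

lemma scaleC_i_i: "scaleC \<i> (scaleC \<i> x) = - x"
  by (metis i_squared of_real_1 of_real_minus scaleC_of_real scaleC_scaleC scaleR_minus1_left)

lemma scaleC_scaleR: "scaleC a (r *\<^sub>R x) = r *\<^sub>R scaleC a x"
  by (metis mult.commute scaleC_of_real scaleC_scaleC)

lemma scaleC_eq: "scaleC l x = Re l *\<^sub>R x + Im l *\<^sub>R scaleC \<i> x"
proof -
  have "scaleC l x = scaleC (complex_of_real (Re l) + complex_of_real (Im l) * \<i>) x"
    by (subst complex_eq[of l]) (simp add: mult.commute)
  then show ?thesis by (simp only: scaleC_add_left scaleC_scaleC[symmetric] scaleC_of_real)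
qed

lemma norm_scaleC: "norm (scaleC l x) = cmod l * norm x"
proof -
  have "inner x (scaleC \<i> x) = 0"
    using inner_scaleC_i[of x x] by (simp add: inner_commute)
  then have "(norm (scaleC l x))\<^sup>2 = ((Re l)\<^sup>2 + (Im l)\<^sup>2) * (norm x)\<^sup>2"
    unfolding power2_norm_eq_inner
    by (simp add: scaleC_eq[of l] inner_add_left inner_add_right inner_scaleC_i scaleC_i_i
        power2_eq_square algebra_simps)
  then have "(norm (scaleC l x))\<^sup>2 = (cmod l * norm x)\<^sup>2"
    by (simp add: cmod_power2 power_mult_distrib)
  then show ?thesis by (simp add: power2_eq_iff_nonneg)
qed

lemma bounded_linear_scaleC: "bounded_linear (scaleC l)"
  by (rule bounded_linear_intro[where K = "cmod l"])
    (simp_all add: scaleC_add_right scaleC_scaleR norm_scaleC mult.commute)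

text \<open>
  If \<open>T\<close> represents the second derivative, then \<open>(T - J T J) / 4\<close> represents the Levi form, where
  \<open>J\<close> is multiplication by the imaginary unit; the minus sign appears because \<open>J\<close> is skew. The
  imaginary part of \<open>\<langle>A s, t\<rangle>\<close> is the real part of \<open>\<langle>A s, J t\<rangle>\<close>, so the real identity determines the
  complex one.
\<close>

lemma inner_levi_op:
  fixes u :: "'a::complex_hilbert \<Rightarrow> real"
  shows "inner (levi_op u a s) t = (D2 u a s t + D2 u a (scaleC \<i> s) (scaleC \<i> t)) / 4"
proof -
  define J where "J = Blinfun (scaleC \<i> :: 'a \<Rightarrow> 'a)"
  have J: "J x = scaleC \<i> x" for x
    unfolding J_def by (simp add: bounded_linear_Blinfun_apply[OF bounded_linear_scaleC])
  obtain T :: "'a \<Rightarrow>\<^sub>L 'a" where T: "\<And>s t. inner (T s) t = D2 u a s t" 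
    using bounded_form_operator[of "D2 u a"] by blast
  define A where "A = (1 / 4) *\<^sub>R (T - (J o\<^sub>L T o\<^sub>L J))"
  have A: "inner (A s) t = (D2 u a s t + D2 u a (scaleC \<i> s) (scaleC \<i> t)) / 4" for s t
    by (simp add: A_def blinfun.scaleR_left blinfun.diff_left inner_diff_left J T inner_scaleC_i)
  have A': "cinner (A s) t = levi_form u a s t" for s t
    by (simp add: cinner_eq_Complex A levi_form_def Let_def complex_eq_iff scaleC_i_i
        blinfun.minus_right blinfun.minus_left)
  have "levi_op u a = A"
    unfolding levi_op_def
  proof (rule the_equality)
    fix B assume B: "\<forall>s t. cinner (blinfun_apply B s) t = levi_form u a s t"
    have "inner (B s) t = inner (A s) t" for s t
      using B A'[of s t] by (simp add: inner_eq_Re_cinner)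
    then have "inner (B s - A s) t = 0" for s t by (simp add: inner_diff_left)
    then have "B s - A s = 0" for s by (metis inner_eq_zero_iff)
    then show "B = A" by (intro blinfun_eqI) simp
  qed (use A' in blast)
  then show ?thesis using A by simp
qed

section \<open>Symmetry of second derivatives\<close>

text \<open>
  The second difference divided by \<open>h\<^sup>2\<close> is close to \<open>W2 t s\<close>: apply the mean value theorem to the
  first difference in direction \<open>t\<close> along \<open>s\<close>, then differentiability of \<open>W1\<close> at \<open>a\<close>. The
  difference itself is symmetric in \<open>s\<close> and \<open>t\<close>, which yields \<open>second_derivative_symmetric\<close>.
\<close>

lemma second_difference_estimate:
  fixes u :: "'a::real_normed_vector \<Rightarrow> real"
  assumes d1: "\<And>z. z \<in> ball a r \<Longrightarrow> (u has_derivative blinfun_apply (W1 z)) (at z)"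
    and d2: "\<And>z. z \<in> ball a r \<Longrightarrow> norm (W1 z - W1 a - blinfun_apply W2 (z - a)) \<le> e * norm (z - a)"
    and h: "0 < h" "h * (norm s + norm t) < r" and e: "0 \<le> e"
  shows "\<bar>(u (a + h *\<^sub>R s + h *\<^sub>R t) - u (a + h *\<^sub>R s) - u (a + h *\<^sub>R t) + u a) - h\<^sup>2 * blinfun_apply (blinfun_apply W2 t) s\<bar>
    \<le> h\<^sup>2 * (2 * e * (norm s + norm t) * norm s)"
proof -
  define g where "g = (\<lambda>\<tau>. u (a + \<tau> *\<^sub>R s + h *\<^sub>R t) - u (a + \<tau> *\<^sub>R s))"
  have nrm: "norm (\<tau> *\<^sub>R s + c *\<^sub>R t) \<le> h * (norm s + norm t)"
    if "0 \<le> \<tau>" "\<tau> \<le> h" "0 \<le> c" "c \<le> h" for \<tau> c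
  proof -
    have "norm (\<tau> *\<^sub>R s + c *\<^sub>R t) \<le> \<tau> * norm s + c * norm t"
      using norm_triangle_ineq[of "\<tau> *\<^sub>R s" "c *\<^sub>R t"] that by simp
    also have "\<dots> \<le> h * norm s + h * norm t" using that by (intro add_mono mult_right_mono) auto
    finally show ?thesis by (simp add: distrib_left)
  qed
  have mem: "a + \<tau> *\<^sub>R s + c *\<^sub>R t \<in> ball a r" if "0 \<le> \<tau>" "\<tau> \<le> h" "0 \<le> c" "c \<le> h" for \<tau> c
  proof -
    have "dist a (a + \<tau> *\<^sub>R s + c *\<^sub>R t) = norm (\<tau> *\<^sub>R s + c *\<^sub>R t)"
      by (simp add: dist_norm norm_minus_commute algebra_simps)
    then show ?thesis using nrm[OF that] h(2) by simp
  qed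
  have gd: "(g has_derivative (\<lambda>k. k * (W1 (a + \<tau> *\<^sub>R s + h *\<^sub>R t) s - W1 (a + \<tau> *\<^sub>R s) s))) (at \<tau>)"
    if "0 \<le> \<tau>" "\<tau> \<le> h" for \<tau>
  proof -
    have m1: "((\<lambda>\<tau>. a + \<tau> *\<^sub>R s + h *\<^sub>R t) has_derivative (\<lambda>k. k *\<^sub>R s)) (at \<tau>)"
      and m2: "((\<lambda>\<tau>. a + \<tau> *\<^sub>R s) has_derivative (\<lambda>k. k *\<^sub>R s)) (at \<tau>)"
      by (auto intro!: derivative_eq_intros)
    have 1: "((\<lambda>\<tau>. u (a + \<tau> *\<^sub>R s + h *\<^sub>R t)) has_derivative (\<lambda>k. W1 (a + \<tau> *\<^sub>R s + h *\<^sub>R t) (k *\<^sub>R s))) (at \<tau>)"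
      by (rule has_derivative_compose[OF m1 d1[OF mem]]) (use that h in auto)
    have 2: "((\<lambda>\<tau>. u (a + \<tau> *\<^sub>R s)) has_derivative (\<lambda>k. W1 (a + \<tau> *\<^sub>R s) (k *\<^sub>R s))) (at \<tau>)"
      by (rule has_derivative_compose[OF m2 d1]) (use mem[of \<tau> 0] that h in simp)
    show ?thesis
      unfolding g_def using has_derivative_diff[OF 1 2]
      by (simp add: blinfun.scaleR_right algebra_simps)
  qed
  obtain \<xi> where \<xi>: "0 < \<xi>" "\<xi> < h"
    "g h - g 0 = (h - 0) * (W1 (a + \<xi> *\<^sub>R s + h *\<^sub>R t) s - W1 (a + \<xi> *\<^sub>R s) s)"
    using mvt[of 0 h g "\<lambda>\<tau> k. k * (W1 (a + \<tau> *\<^sub>R s + h *\<^sub>R t) s - W1 (a + \<tau> *\<^sub>R s) s)"] h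
      gd has_derivative_at_withinI[OF gd] has_derivative_continuous[OF gd]
    by (auto simp: continuous_at_imp_continuous_on)
  define E1 where "E1 = W1 (a + \<xi> *\<^sub>R s + h *\<^sub>R t) - W1 a - W2 (\<xi> *\<^sub>R s + h *\<^sub>R t)"
  define E2 where "E2 = W1 (a + \<xi> *\<^sub>R s) - W1 a - W2 (\<xi> *\<^sub>R s)"
  have E: "norm E1 \<le> e * (h * (norm s + norm t))" "norm E2 \<le> e * (h * (norm s + norm t))"
  proof -
    have "norm E1 \<le> e * norm (\<xi> *\<^sub>R s + h *\<^sub>R t)"
      using d2[OF mem[of \<xi> h]] \<xi> h by (simp add: E1_def add.assoc)
    also have "\<dots> \<le> e * (h * (norm s + norm t))"
      using nrm[of \<xi> h] \<xi> h e by (intro mult_left_mono) auto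
    finally show "norm E1 \<le> e * (h * (norm s + norm t))" .
    have "norm E2 \<le> e * norm (\<xi> *\<^sub>R s + 0 *\<^sub>R t)"
      using d2[OF mem[of \<xi> 0]] \<xi> h by (simp add: E2_def add.assoc)
    also have "\<dots> \<le> e * (h * (norm s + norm t))"
      using nrm[of \<xi> 0] \<xi> h e by (intro mult_left_mono) auto
    finally show "norm E2 \<le> e * (h * (norm s + norm t))" .
  qed
  have "W1 (a + \<xi> *\<^sub>R s + h *\<^sub>R t) s - W1 (a + \<xi> *\<^sub>R s) s = h * W2 t s + (E1 - E2) s"
    by (simp add: E1_def E2_def blinfun.diff_left blinfun.add_right blinfun.add_left blinfun.scaleR_right
        blinfun.scaleR_left)
  then have "(g h - g 0) - h\<^sup>2 * W2 t s = h * (E1 - E2) s"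
    using \<xi>(3) by (simp add: power2_eq_square algebra_simps)
  moreover have "\<bar>(E1 - E2) s\<bar> \<le> 2 * (e * (h * (norm s + norm t))) * norm s"
  proof -
    have "\<bar>(E1 - E2) s\<bar> \<le> norm (E1 - E2) * norm s" using norm_blinfun[of "E1 - E2" s] by simp
    also have "\<dots> \<le> 2 * (e * (h * (norm s + norm t))) * norm s"
      using norm_triangle_ineq4[of E1 E2] E by (intro mult_right_mono) auto
    finally show ?thesis .
  qed
  ultimately have "\<bar>(g h - g 0) - h\<^sup>2 * W2 t s\<bar> \<le> h * (2 * (e * (h * (norm s + norm t))) * norm s)"
    using h by (simp add: abs_mult)
  then show ?thesis by (simp add: g_def power2_eq_square algebra_simps)
qed

lemma second_derivative_symmetric:
  fixes u :: "'a::real_normed_vector \<Rightarrow> real"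
  assumes S: "open S" "a \<in> S"
    and d1: "\<And>z. z \<in> S \<Longrightarrow> (u has_derivative blinfun_apply (W1 z)) (at z)"
    and d2: "(W1 has_derivative blinfun_apply W2) (at a)"
  shows "blinfun_apply (blinfun_apply W2 s) t = blinfun_apply (blinfun_apply W2 t) s"
proof -
  define N where "N = norm s + norm t"
  have "\<bar>W2 s t - W2 t s\<bar> \<le> 0 + e" if e: "0 < e" for e
  proof -
    define e' where "e' = e / (2 * N * N + 1)"
    have N0: "0 \<le> N" by (simp add: N_def)
    have pos: "2 * N * N + 1 > 0" using N0 by (simp add: add_nonneg_pos)
    have e': "0 < e'" "2 * e' * N * N \<le> e"
      using e pos by (auto simp: e'_def divide_simps)
    obtain d where d: "0 < d" "\<And>z. norm (z - a) < d \<Longrightarrow> norm (W1 z - W1 a - W2 (z - a)) \<le> e' * norm (z - a)"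
      using d2 e'(1) unfolding has_derivative_at_alt by blast
    obtain r where r: "0 < r" "ball a r \<subseteq> S" using S open_contains_ball by blast
    define h where "h = min d r / (2 * (N + 1))"
    have h: "0 < h" using d r N0 by (simp add: h_def)
    have hN: "h * N < min d r"
    proof -
      have "h * N \<le> h * (N + 1)" using h by simp
      also have "\<dots> = min d r / 2" using N0 by (simp add: h_def field_simps)
      also have "\<dots> < min d r" using d r by (simp add: min_def)
      finally show ?thesis .
    qed
    have b: "z \<in> ball a (min d r) \<Longrightarrow> (u has_derivative blinfun_apply (W1 z)) (at z)"
      "z \<in> ball a (min d r) \<Longrightarrow> norm (W1 z - W1 a - W2 (z - a)) \<le> e' * norm (z - a)" for z
      using d1 r(2) d(2)[of z] by (auto simp: dist_norm norm_minus_commute)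
    have 1: "\<bar>(u (a + h *\<^sub>R s + h *\<^sub>R t) - u (a + h *\<^sub>R s) - u (a + h *\<^sub>R t) + u a) - h\<^sup>2 * W2 t s\<bar>
        \<le> h\<^sup>2 * (2 * e' * N * norm s)"
      using second_difference_estimate[where r = "min d r" and s = s and t = t, OF b h] hN e'(1) by (simp add: N_def)
    have 2: "\<bar>(u (a + h *\<^sub>R t + h *\<^sub>R s) - u (a + h *\<^sub>R t) - u (a + h *\<^sub>R s) + u a) - h\<^sup>2 * W2 s t\<bar>
        \<le> h\<^sup>2 * (2 * e' * N * norm t)"
      using second_difference_estimate[where r = "min d r" and s = t and t = s, OF b h] hN e'(1) by (simp add: N_def add.commute)
    have "a + h *\<^sub>R t + h *\<^sub>R s = a + h *\<^sub>R s + h *\<^sub>R t" by simp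
    with 1 2 have "\<bar>h\<^sup>2 * W2 s t - h\<^sup>2 * W2 t s\<bar> \<le> h\<^sup>2 * (2 * e' * N * norm s) + h\<^sup>2 * (2 * e' * N * norm t)"
      by (smt (verit))
    also have "\<dots> = h\<^sup>2 * (2 * e' * N * N)" by (simp add: N_def algebra_simps)
    also have "\<bar>h\<^sup>2 * W2 s t - h\<^sup>2 * W2 t s\<bar> = h\<^sup>2 * \<bar>W2 s t - W2 t s\<bar>"
      by (simp add: right_diff_distrib[symmetric] abs_mult)
    finally have "\<bar>W2 s t - W2 t s\<bar> \<le> 2 * e' * N * N" using h by simp
    then show ?thesis using e'(2) by simp
  qed
  then have "\<bar>W2 s t - W2 t s\<bar> \<le> 0" by (rule field_le_epsilon)
  then show ?thesis by simp
qed

section \<open>Circle means of subharmonic functions\<close>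

lemma cis_derivatives:
  "((\<lambda>r. complex_of_real r * cis \<theta>) has_derivative (\<lambda>k. k *\<^sub>R cis \<theta>)) (at r within S)"
  "((\<lambda>\<theta>. complex_of_real r * cis \<theta>) has_derivative (\<lambda>k. (k * r) *\<^sub>R (\<i> * cis \<theta>))) (at \<theta> within T)"
proof -
  show "((\<lambda>r. complex_of_real r * cis \<theta>) has_derivative (\<lambda>k. k *\<^sub>R cis \<theta>)) (at r within S)"
    by (auto intro!: derivative_eq_intros simp: scaleR_conv_of_real)
  have "(cis has_vector_derivative \<i> * cis \<theta>) (at \<theta> within T)"
    unfolding has_vector_derivative_complex_iff
    by (auto intro!: derivative_eq_intros simp: cis.ctr)
  then have "(cis has_derivative (\<lambda>k. k *\<^sub>R (\<i> * cis \<theta>))) (at \<theta> within T)"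
    by (simp add: has_vector_derivative_def)
  then show "((\<lambda>\<theta>. complex_of_real r * cis \<theta>) has_derivative (\<lambda>k. (k * r) *\<^sub>R (\<i> * cis \<theta>))) (at \<theta> within T)"
    by (auto intro!: derivative_eq_intros simp: scaleR_conv_of_real algebra_simps)
qed

text \<open>
  Let \<open>m r\<close> be the integral of \<open>g\<close> over the circle of radius \<open>r\<close>, with respect to the angle, and
  \<open>n r = r m' r\<close>. In polar coordinates \<open>r (r g\<^sub>r)\<^sub>r\<close> is \<open>r\<^sup>2\<close> times the Laplacian minus \<open>g\<^sub>\<theta>\<^sub>\<theta>\<close>, and
  the integral of the latter vanishes by periodicity. So \<open>n\<close> increases from \<open>n 0 = 0\<close>, and therefore
  \<open>m\<close> increases from \<open>m 0 = 2 \<pi> g 0\<close> to \<open>m 1\<close>.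
\<close>

lemma subharmonic_le_circle_mean:
  fixes g gx gy gxx gxy gyx gyy :: "complex \<Rightarrow> real"
  assumes d0: "\<And>p. cmod p \<le> 1 \<Longrightarrow> (g has_derivative (\<lambda>k. Re k * gx p + Im k * gy p)) (at p)"
    and dx: "\<And>p. cmod p \<le> 1 \<Longrightarrow> (gx has_derivative (\<lambda>k. Re k * gxx p + Im k * gxy p)) (at p)"
    and dy: "\<And>p. cmod p \<le> 1 \<Longrightarrow> (gy has_derivative (\<lambda>k. Re k * gyx p + Im k * gyy p)) (at p)"
    and cont: "continuous_on (cball 0 1) gxx" "continuous_on (cball 0 1) gxy"
      "continuous_on (cball 0 1) gyx" "continuous_on (cball 0 1) gyy"
    and pos: "\<And>p. cmod p \<le> 1 \<Longrightarrow> 0 \<le> gxx p + gyy p"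
  shows "2 * pi * g 0 \<le> integral {0..2 * pi} (\<lambda>\<theta>. g (cis \<theta>))"
proof -
  define P where "P = (\<lambda>r \<theta>. complex_of_real r * cis \<theta>)"
  have P: "cmod (P r \<theta>) \<le> 1" if "r \<in> {0..1}" for r \<theta>
    using that by (simp add: P_def norm_mult)
  have cP: "continuous_on ({0..1} \<times> T) (\<lambda>x. P (fst x) (snd x))" for T
    unfolding P_def by (intro continuous_intros)
  have c0: "continuous_on (cball 0 1) g" "continuous_on (cball 0 1) gx" "continuous_on (cball 0 1) gy"
    using has_derivative_continuous[OF d0] has_derivative_continuous[OF dx] has_derivative_continuous[OF dy]
    by (auto intro!: continuous_at_imp_continuous_on)
  note cg = c0 cont
  have comp: "continuous_on ({0..1} \<times> T) (\<lambda>x. f (P (fst x) (snd x)))"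
    if "continuous_on (cball 0 1) f" for f :: "complex \<Rightarrow> real" and T
    by (rule continuous_on_compose2[OF that cP]) (use P in auto)
  have comp1: "continuous_on T (\<lambda>\<theta>. f (P r \<theta>))"
    if "continuous_on (cball 0 1) f" "r \<in> {0..1}" for f :: "complex \<Rightarrow> real" and T r
    by (rule continuous_on_compose2[OF that(1)]) (use P that in \<open>auto simp: P_def intro!: continuous_intros\<close>)
  have dr: "((\<lambda>r. f (P r \<theta>)) has_field_derivative (cos \<theta> * fx (P r \<theta>) + sin \<theta> * fy (P r \<theta>))) (at r within {0..1})"
    if "\<And>p. cmod p \<le> 1 \<Longrightarrow> (f has_derivative (\<lambda>k. Re k * fx p + Im k * fy p)) (at p)" "r \<in> {0..1}"
    for f fx fy :: "complex \<Rightarrow> real" and r \<theta>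
    unfolding has_field_derivative_def P_def
    by (rule has_derivative_eq_rhs[OF has_derivative_compose[OF cis_derivatives(1) that(1)[OF P[OF that(2)], unfolded P_def]]])
      (simp add: fun_eq_iff algebra_simps)
  have dth: "((\<lambda>\<theta>. f (P r \<theta>)) has_field_derivative (r * (- sin \<theta> * fx (P r \<theta>) + cos \<theta> * fy (P r \<theta>)))) (at \<theta> within T)"
    if "\<And>p. cmod p \<le> 1 \<Longrightarrow> (f has_derivative (\<lambda>k. Re k * fx p + Im k * fy p)) (at p)" "r \<in> {0..1}"
    for f fx fy :: "complex \<Rightarrow> real" and r \<theta> T
    unfolding has_field_derivative_def P_def
    by (rule has_derivative_eq_rhs[OF has_derivative_compose[OF cis_derivatives(2) that(1)[OF P[OF that(2)], unfolded P_def]]])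
      (simp add: fun_eq_iff algebra_simps)
  define m where "m = (\<lambda>r. integral {0..2 * pi} (\<lambda>\<theta>. g (P r \<theta>)))"
  define N where "N = (\<lambda>r \<theta>. cos \<theta> * gx (P r \<theta>) + sin \<theta> * gy (P r \<theta>))"
  define K where "K = (\<lambda>r \<theta>. N r \<theta> + r * (cos \<theta> * (cos \<theta> * gxx (P r \<theta>) + sin \<theta> * gxy (P r \<theta>))
      + sin \<theta> * (cos \<theta> * gyx (P r \<theta>) + sin \<theta> * gyy (P r \<theta>))))"
  define n where "n = (\<lambda>r. integral {0..2 * pi} (\<lambda>\<theta>. r * N r \<theta>))"
  have cN: "continuous_on {0..2 * pi} (N r)" if "r \<in> {0..1}" for r
    unfolding N_def using that by (intro continuous_intros comp1 cg)
  have m': "(m has_field_derivative integral {0..2 * pi} (N r)) (at r within {0..1})"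
    if "r \<in> {0..1}" for r
    unfolding m_def cbox_interval[symmetric]
  proof (rule leibniz_rule_field_derivative)
    show "((\<lambda>x. g (P x t)) has_field_derivative N x t) (at x within cbox 0 1)" if "x \<in> cbox 0 1" for x t
      using dr[OF d0] that by (simp add: N_def)
    show "(\<lambda>\<theta>. g (P x \<theta>)) integrable_on cbox 0 (2 * pi)" if "x \<in> cbox 0 1" for x
      using that by (intro integrable_continuous comp1 cg) simp
    show "continuous_on (cbox 0 1 \<times> cbox 0 (2 * pi)) (\<lambda>(x, t). N x t)"
      unfolding N_def split_beta cbox_interval by (intro continuous_intros comp cg)
  qed (use that in auto)
  have n': "(n has_field_derivative integral {0..2 * pi} (K r)) (at r within {0..1})"
    if "r \<in> {0..1}" for r
    unfolding n_def cbox_interval[symmetric]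
  proof (rule leibniz_rule_field_derivative)
    show "((\<lambda>x. x * N x t) has_field_derivative K x t) (at x within cbox 0 1)" if "x \<in> cbox 0 1" for x t
      unfolding N_def K_def
      by (rule derivative_eq_intros dr[OF dx] dr[OF dy] refl | use that in \<open>simp add: algebra_simps\<close>)+
    show "(\<lambda>\<theta>. x * N x \<theta>) integrable_on cbox 0 (2 * pi)" if "x \<in> cbox 0 1" for x
      using that cN by (intro integrable_continuous continuous_intros) simp
    show "continuous_on (cbox 0 1 \<times> cbox 0 (2 * pi)) (\<lambda>(x, t). K x t)"
      unfolding K_def N_def split_beta cbox_interval by (intro continuous_intros comp cg)
  qed (use that in auto)
  have K_pos: "0 \<le> integral {0..2 * pi} (K r)" if r: "r \<in> {0..1}" for r
  proof -
    \<comment> \<open>\<open>r Q\<close> is the angular derivative of \<open>g\<close>, and \<open>K r + Q'\<close> is \<open>r\<close> times the Laplacian.\<close>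
    define Q where "Q = (\<lambda>\<theta>. - sin \<theta> * gx (P r \<theta>) + cos \<theta> * gy (P r \<theta>))"
    define Q' where "Q' = (\<lambda>\<theta>. r * (gxx (P r \<theta>) + gyy (P r \<theta>)) - K r \<theta>)"
    have "(Q has_field_derivative Q' \<theta>) (at \<theta> within {0..2 * pi})" for \<theta>
    proof -
      have "(Q has_field_derivative
        (- sin \<theta> * (r * (- sin \<theta> * gxx (P r \<theta>) + cos \<theta> * gxy (P r \<theta>))) + - cos \<theta> * gx (P r \<theta>)
        + (cos \<theta> * (r * (- sin \<theta> * gyx (P r \<theta>) + cos \<theta> * gyy (P r \<theta>))) + - sin \<theta> * gy (P r \<theta>))))
        (at \<theta> within {0..2 * pi})"
        unfolding Q_def
        by (rule derivative_eq_intros dth[OF dx r] dth[OF dy r] refl | simp)+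
      moreover have "- sin \<theta> * (r * (- sin \<theta> * gxx (P r \<theta>) + cos \<theta> * gxy (P r \<theta>))) + - cos \<theta> * gx (P r \<theta>)
        + (cos \<theta> * (r * (- sin \<theta> * gyx (P r \<theta>) + cos \<theta> * gyy (P r \<theta>))) + - sin \<theta> * gy (P r \<theta>)) = Q' \<theta>"
      proof -
        have s: "sin \<theta> * sin \<theta> = 1 - cos \<theta> * cos \<theta>"
          using sin_cos_squared_add[of \<theta>] by (simp add: power2_eq_square)
        show ?thesis
          unfolding Q'_def K_def N_def
          using arg_cong[OF s, of "\<lambda>x. x * (r * gxx (P r \<theta>))"] arg_cong[OF s, of "\<lambda>x. x * (r * gyy (P r \<theta>))"]
          by (simp add: algebra_simps)
      qed
      ultimately show ?thesis by simp
    qed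
    then have "(Q' has_integral Q (2 * pi) - Q 0) {0..2 * pi}"
      by (intro fundamental_theorem_of_calculus)
        (auto simp: has_real_derivative_iff_has_vector_derivative[symmetric])
    moreover have "Q (2 * pi) = Q 0" by (simp add: Q_def P_def cis.ctr)
    ultimately have Q0: "(Q' has_integral 0) {0..2 * pi}" by simp
    have cK: "continuous_on {0..2 * pi} (K r)"
      unfolding K_def using r by (intro continuous_intros comp1 cg cN)
    then have "(K r has_integral integral {0..2 * pi} (K r)) {0..2 * pi}"
      by (intro integrable_integral integrable_continuous_interval)
    from has_integral_add[OF this Q0]
    have "((\<lambda>\<theta>. r * (gxx (P r \<theta>) + gyy (P r \<theta>))) has_integral integral {0..2 * pi} (K r)) {0..2 * pi}"
      by (simp add: Q'_def)
    then show ?thesis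
      by (rule has_integral_nonneg) (use r pos P in \<open>auto intro!: mult_nonneg_nonneg\<close>)
  qed
  have interior: "(f has_field_derivative D) (at x)" if "(f has_field_derivative D) (at x within {0..1})" "0 < x" "x < 1"
    for f D and x :: real
    using that at_within_Icc_at[of 0 x 1] by simp
  have n_nonneg: "0 \<le> n r" if r: "r \<in> {0..1}" for r
  proof -
    have "n 0 \<le> n r"
    proof (rule DERIV_nonneg_imp_increasing_open[of 0 r n])
      show "\<exists>y. (n has_real_derivative y) (at x) \<and> 0 \<le> y" if "0 < x" "x < r" for x
        using interior[OF n'[of x]] K_pos[of x] that r by auto
      show "continuous_on {0..r} n"
        by (rule continuous_on_subset[of "{0..1}"]) (use r DERIV_continuous_on[OF n'] in auto)
    qed (use r in simp)
    then show ?thesis by (simp add: n_def)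
  qed
  have "m 0 \<le> m 1"
  proof (rule DERIV_nonneg_imp_increasing_open[of 0 1 m])
    show "\<exists>y. (m has_real_derivative y) (at x) \<and> 0 \<le> y" if x: "0 < x" "x < 1" for x
    proof -
      have "n x = x * integral {0..2 * pi} (N x)" by (simp add: n_def)
      then have "0 \<le> integral {0..2 * pi} (N x)" using n_nonneg[of x] x by (simp add: zero_le_mult_iff)
      then show ?thesis using interior[OF m'[of x]] x by auto
    qed
    show "continuous_on {0..1} m" using m' by (rule DERIV_continuous_on)
  qed simp
  then show ?thesis by (simp add: m_def P_def)
qed

lemma ereal_integral_continuous:
  assumes "continuous_on {a..b} f"
  shows "ereal_integral {a..b} (\<lambda>\<theta>. ereal (f \<theta>)) = ereal (integral {a..b} f)"
proof -
  have part: "enn2ereal (\<integral>\<^sup>+ \<theta>\<in>{a..b}. e2ennreal (ereal (h \<theta>)) \<partial>lborel) = ereal (integral {a..b} (\<lambda>\<theta>. max 0 (h \<theta>)))"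
    if h: "continuous_on {a..b} h" for h :: "real \<Rightarrow> real"
  proof -
    have c: "continuous_on {a..b} (\<lambda>\<theta>. max 0 (h \<theta>))" by (intro continuous_intros h)
    have "((\<lambda>\<theta>. max 0 (h \<theta>)) has_integral integral {a..b} (\<lambda>\<theta>. max 0 (h \<theta>))) {a..b}"
      by (intro integrable_integral integrable_continuous_interval c)
    then have "(\<integral>\<^sup>+ \<theta>. ennreal (max 0 (h \<theta>)) * indicator {a..b} \<theta> \<partial>lborel) = ennreal (integral {a..b} (\<lambda>\<theta>. max 0 (h \<theta>)))"
      by (rule nn_integral_has_integral_lebesgue'[rotated]) simp
    moreover have "e2ennreal (ereal (h \<theta>)) = ennreal (max 0 (h \<theta>))" for \<theta>
      by (simp add: max_def ennreal_neg)
    moreover have "0 \<le> integral {a..b} (\<lambda>\<theta>. max 0 (h \<theta>))"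
      by (rule integral_nonneg) (auto intro: integrable_continuous_interval c)
    ultimately show ?thesis by simp
  qed
  have "integral {a..b} (\<lambda>\<theta>. max 0 (f \<theta>)) - integral {a..b} (\<lambda>\<theta>. max 0 (- f \<theta>))
      = integral {a..b} (\<lambda>\<theta>. max 0 (f \<theta>) - max 0 (- f \<theta>))"
    by (intro integral_diff[symmetric] integrable_continuous_interval continuous_intros assms)
  also have "(\<lambda>\<theta>. max 0 (f \<theta>) - max 0 (- f \<theta>)) = f" by (auto simp: max_def)
  finally show ?thesis
    unfolding ereal_integral_def using part[OF assms] part[OF continuous_on_minus[OF assms]] by simp
qed

section \<open>Plurisubharmonic functions of class C2\<close>

lemma bounded_linear_scaleC_left: "bounded_linear (\<lambda>l. scaleC l h)"
  by (rule bounded_linear_intro[where K = "norm h"])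
    (simp_all add: scaleC_add_left norm_scaleC scaleR_conv_of_real scaleC_scaleC[symmetric] scaleC_of_real)

lemmas continuous_on_scaleC_left [continuous_intros] =
  bounded_linear.continuous_on[OF bounded_linear_scaleC_left]

lemma scaleC_zero [simp]: "scaleC 0 h = 0" "scaleC l 0 = 0"
  using norm_scaleC[of 0 h] norm_scaleC[of l 0] by simp_all

text \<open>
  \<open>W1 z e\<close> is the derivative of \<open>w\<close> at \<open>z\<close> in direction \<open>e\<close>, and \<open>W2 z k e\<close> that of \<open>W1 z e\<close> in
  direction \<open>k\<close>. The derivatives are evaluated on vectors, so that linear combinations and the
  squared norm can be treated without operator-valued maps.
\<close>

definition C2_with :: "'a::complex_hilbert set \<Rightarrow> ('a \<Rightarrow> real) \<Rightarrow> ('a \<Rightarrow> 'a \<Rightarrow> real) \<Rightarrow> ('a \<Rightarrow> 'a \<Rightarrow> 'a \<Rightarrow> real) \<Rightarrow> bool"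
  where "C2_with S w W1 W2 \<longleftrightarrow>
    (\<forall>z\<in>S. (w has_derivative W1 z) (at z)) \<and>
    (\<forall>z\<in>S. \<forall>e. ((\<lambda>y. W1 y e) has_derivative (\<lambda>k. W2 z k e)) (at z)) \<and>
    (\<forall>k e. continuous_on S (\<lambda>z. W2 z k e))"

lemma C2_with_lincomb:
  assumes "C2_with S w W1 W2" "C2_with S v V1 V2"
  shows "C2_with S (\<lambda>z. a * w z + b * v z) (\<lambda>z e. a * W1 z e + b * V1 z e)
    (\<lambda>z k e. a * W2 z k e + b * V2 z k e)"
  using assms unfolding C2_with_def
  by (auto intro!: has_derivative_add has_derivative_mult_right continuous_intros)

lemma C2_with_subset: "C2_with S w W1 W2 \<Longrightarrow> T \<subseteq> S \<Longrightarrow> C2_with T w W1 W2"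
  unfolding C2_with_def using continuous_on_subset by blast

lemma C2_with_norm_sq:
  "C2_with S (\<lambda>z. (norm (z - c))\<^sup>2) (\<lambda>z e. 2 * inner (z - c) e) (\<lambda>z k e. 2 * inner k e)"
  unfolding C2_with_def power2_norm_eq_inner
  by (auto intro!: derivative_eq_intros simp: inner_commute fun_eq_iff)

lemma C2_closure_derivatives:
  assumes "C2_closure \<Omega> u" "z \<in> \<Omega>"
  shows "(u has_derivative D1 u z) (at z)" "(D1 u has_derivative D2 u z) (at z)"
proof -
  have d: "u differentiable (at z)" "D1 u differentiable (at z)"
    using assms by (auto simp: C2_closure_def)
  then show "(u has_derivative D1 u z) (at z)" "(D1 u has_derivative D2 u z) (at z)"
    unfolding D1_def[of u z] D2_def[of u z]
    by (simp_all add: frechet_derivative_works bounded_linear_Blinfun_apply has_derivative_bounded_linear)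
qed

lemma C2_with_C2_closure:
  assumes "C2_closure \<Omega> u"
  shows "C2_with \<Omega> u (\<lambda>z. D1 u z) (\<lambda>z k e. D2 u z k e)"
  unfolding C2_with_def
proof (intro conjI ballI allI)
  fix z e assume z: "z \<in> \<Omega>"
  show "(u has_derivative D1 u z) (at z)" by (rule C2_closure_derivatives[OF assms z])
  show "((\<lambda>y. D1 u y e) has_derivative (\<lambda>k. D2 u z k e)) (at z)"
    by (rule bounded_linear.has_derivative[OF blinfun.bounded_linear_left C2_closure_derivatives(2)[OF assms z]])
next
  fix k e
  obtain G where "continuous_on (closure \<Omega>) G" "\<forall>z\<in>\<Omega>. G z = D2 u z"
    using assms by (auto simp: C2_closure_def)
  then have "continuous_on \<Omega> (D2 u)"
    by (metis closure_subset continuous_on_cong continuous_on_subset)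
  then show "continuous_on \<Omega> (\<lambda>z. D2 u z k e)" by (intro continuous_intros)
qed

lemma D2_symmetric:
  assumes "open \<Omega>" "C2_closure \<Omega> u" "z \<in> \<Omega>"
  shows "D2 u z s t = D2 u z t s"
  using second_derivative_symmetric[OF assms(1,3) C2_closure_derivatives(1)[OF assms(2)]
      C2_closure_derivatives(2)[OF assms(2,3)]] .

lemma C2_with_submean:
  assumes C2: "C2_with S w W1 W2"
    and disc: "\<And>l. cmod l \<le> 1 \<Longrightarrow> z + scaleC l h \<in> S"
    and pos: "\<And>y. y \<in> S \<Longrightarrow> 0 \<le> W2 y h h + W2 y (scaleC \<i> h) (scaleC \<i> h)"
  shows "2 * pi * w z \<le> integral {0..2 * pi} (\<lambda>\<theta>. w (z + scaleC (cis \<theta>) h))"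
proof -
  let ?L = "\<lambda>l. z + scaleC l h"
  have line: "(?L has_derivative (\<lambda>k. scaleC k h)) (at p)" for p
    using has_derivative_add[OF has_derivative_const
        bounded_linear_imp_has_derivative[OF bounded_linear_scaleC_left]] by simp
  have cont: "continuous_on (cball 0 1) ?L" by (intro continuous_intros)
  have d: "((\<lambda>l. f (?L l)) has_derivative (\<lambda>k. Re k * f' h + Im k * f' (scaleC \<i> h))) (at p)"
    if "(f has_derivative f') (at (?L p))" for f f' p
  proof -
    interpret f': bounded_linear f' using that by (rule has_derivative_bounded_linear)
    have "(\<lambda>k. f' (scaleC k h)) = (\<lambda>k. Re k * f' h + Im k * f' (scaleC \<i> h))"
      by (rule ext, subst scaleC_eq) (simp add: f'.add f'.scaleR)
    then show ?thesis by (rule has_derivative_eq_rhs[OF has_derivative_compose[OF line that]])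
  qed
  have c: "continuous_on (cball 0 1) (\<lambda>p. W2 (?L p) k e)" for k e
    by (rule continuous_on_compose2[OF _ cont, of S "\<lambda>y. W2 y k e"]) (use C2 disc in \<open>auto simp: C2_with_def\<close>)
  have "2 * pi * w (?L 0) \<le> integral {0..2 * pi} (\<lambda>\<theta>. w (?L (cis \<theta>)))"
    by (rule subharmonic_le_circle_mean[OF d d d c c c c])
      (use C2 disc pos in \<open>auto simp: C2_with_def\<close>)
  then show ?thesis by simp
qed

lemma continuous_circle:
  assumes "continuous_on S w" "\<And>l. cmod l \<le> 1 \<Longrightarrow> z + scaleC l h \<in> S"
  shows "continuous_on T (\<lambda>\<theta>. w (z + scaleC (cis \<theta>) h))"
proof (rule continuous_on_compose2[OF assms(1)])
  show "continuous_on T (\<lambda>\<theta>. z + scaleC (cis \<theta>) h)"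
    by (intro continuous_intros)
qed (use assms(2) in auto)

text \<open>
  Continuity makes upper semicontinuity and finiteness automatic, and it keeps the positive and
  negative parts of the integral finite, so that their difference is the ordinary integral.
\<close>

lemma psh_iff_continuous:
  assumes cont: "continuous_on \<Omega> w"
  shows "psh \<Omega> (\<lambda>z. ereal (w z)) \<longleftrightarrow>
    (\<forall>z\<in>\<Omega>. \<forall>h. (\<forall>l. cmod l \<le> 1 \<longrightarrow> z + scaleC l h \<in> \<Omega>) \<longrightarrow>
      2 * pi * w z \<le> integral {0..2 * pi} (\<lambda>\<theta>. w (z + scaleC (cis \<theta>) h)))"
proof -
  have "usc_on \<Omega> (\<lambda>z. ereal (w z))"
    unfolding usc_on_def
  proof (intro ballI allI impI)
    fix z c assume "z \<in> \<Omega>" "ereal (w z) < c"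
    moreover have "((\<lambda>y. ereal (w y)) \<longlongrightarrow> ereal (w z)) (at z within \<Omega>)"
      using cont \<open>z \<in> \<Omega>\<close> by (auto simp: continuous_on_def)
    ultimately show "\<forall>\<^sub>F y in at z within \<Omega>. ereal (w y) < c" using order_tendstoD(2) by blast
  qed
  moreover have "\<exists>z\<in>K. ereal (w z) \<noteq> - \<infinity>" if "K \<in> components \<Omega>" for K
    using in_components_nonempty[OF that] by auto
  moreover have "ereal (w z) \<le> ereal (1 / (2 * pi)) * ereal_integral {0..2 * pi} (\<lambda>\<theta>. ereal (w (z + scaleC (cis \<theta>) h)))
      \<longleftrightarrow> 2 * pi * w z \<le> integral {0..2 * pi} (\<lambda>\<theta>. w (z + scaleC (cis \<theta>) h))"
    if "\<forall>l. cmod l \<le> 1 \<longrightarrow> z + scaleC l h \<in> \<Omega>" for z h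
    using that
    by (subst ereal_integral_continuous) (auto intro!: continuous_circle[OF cont] simp: field_simps)
  ultimately show ?thesis unfolding psh_def by auto
qed

lemma D2_scaleR:
  "D2 u z (r *\<^sub>R s) (r *\<^sub>R t) = r\<^sup>2 * D2 u z s t"
  by (simp add: blinfun.scaleR_left blinfun.scaleR_right power2_eq_square)

text \<open>
  If the form were negative at \<open>h\<close>, it would stay below half its value at \<open>z\<close> on a small disc around \<open>z\<close>. Then
  \<open>- u - c \<parallel>y - z\<parallel>\<^sup>2\<close> would still be subharmonic there for a small \<open>c > 0\<close>, and its mean value inequality
  says that \<open>u\<close> strictly exceeds its circle mean at \<open>z\<close>, since \<open>\<parallel>y - z\<parallel>\<close> is constant on the circle.
\<close>

lemma psh_levi_nonneg:
  assumes op: "open \<Omega>" and C2: "C2_closure \<Omega> u" and psh: "psh \<Omega> (\<lambda>z. ereal (u z))" and z: "z \<in> \<Omega>"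
  shows "0 \<le> D2 u z h h + D2 u z (scaleC \<i> h) (scaleC \<i> h)"
proof (rule ccontr)
  define lap where "lap = (\<lambda>y. D2 u y h h + D2 u y (scaleC \<i> h) (scaleC \<i> h))"
  assume "\<not> 0 \<le> D2 u z h h + D2 u z (scaleC \<i> h) (scaleC \<i> h)"
  then have neg: "lap z < 0" by (simp add: lap_def)
  then have h: "h \<noteq> 0" by (auto simp: lap_def)
  note C2' = C2_with_C2_closure[OF C2]
  have cu: "continuous_on \<Omega> u"
    by (rule continuous_on_subset[OF _ closure_subset]) (use C2 in \<open>simp add: C2_closure_def\<close>)
  define c where "c = - lap z / (8 * (norm h)\<^sup>2)"
  have c: "c > 0" "4 * c * (norm h)\<^sup>2 = - lap z / 2" using neg h by (auto simp: c_def divide_less_0_iff)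
  have "continuous_on \<Omega> lap"
    using C2' unfolding lap_def C2_with_def by (intro continuous_on_add) auto
  then have "(lap \<longlongrightarrow> lap z) (at z)"
    using op z by (metis at_within_open continuous_on_def)
  then have "\<forall>\<^sub>F y in at z. lap y < lap z / 2" using neg by (intro order_tendstoD(2)) auto
  then obtain d where d: "d > 0" "\<And>y. dist y z < d \<Longrightarrow> y \<noteq> z \<Longrightarrow> lap y < lap z / 2"
    unfolding eventually_at by auto
  obtain r where r: "r > 0" "ball z r \<subseteq> \<Omega>" using op z open_contains_ball by blast
  define S where "S = ball z (min d r)"
  have S: "S \<subseteq> \<Omega>" and lapS: "\<And>y. y \<in> S \<Longrightarrow> lap y \<le> lap z / 2"
    using r d(2) neg by (fastforce simp: S_def dist_commute)+
  define \<rho> where "\<rho> = min d r / (2 * norm h)"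
  have \<rho>: "\<rho> > 0" "norm (\<rho> *\<^sub>R h) < min d r" using d r h by (auto simp: \<rho>_def min_def)
  have disc: "z + scaleC l (\<rho> *\<^sub>R h) \<in> S" if "cmod l \<le> 1" for l
  proof -
    have "norm (scaleC l (\<rho> *\<^sub>R h)) \<le> norm (\<rho> *\<^sub>R h)"
      unfolding norm_scaleC using that by (intro mult_left_le_one_le) auto
    then show ?thesis using \<rho>(2) by (simp add: S_def dist_norm)
  qed
  have "2 * pi * ((- 1) * u z + (- c) * (norm (z - z))\<^sup>2)
      \<le> integral {0..2 * pi} (\<lambda>\<theta>. (- 1) * u (z + scaleC (cis \<theta>) (\<rho> *\<^sub>R h)) + (- c) * (norm (z + scaleC (cis \<theta>) (\<rho> *\<^sub>R h) - z))\<^sup>2)"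
  proof (rule C2_with_submean[OF C2_with_lincomb[OF C2_with_subset[OF C2' S] C2_with_norm_sq] disc])
    fix y assume "y \<in> S"
    have "4 * c * (norm h)\<^sup>2 \<le> - lap y" using lapS[OF \<open>y \<in> S\<close>] c(2) by simp
    then have "0 \<le> \<rho>\<^sup>2 * (- lap y - 4 * c * (norm h)\<^sup>2)" by simp
    also have "\<dots> = (- 1) * D2 u y (\<rho> *\<^sub>R h) (\<rho> *\<^sub>R h) + (- c) * (2 * inner (\<rho> *\<^sub>R h) (\<rho> *\<^sub>R h))
      + ((- 1) * D2 u y (scaleC \<i> (\<rho> *\<^sub>R h)) (scaleC \<i> (\<rho> *\<^sub>R h))
        + (- c) * (2 * inner (scaleC \<i> (\<rho> *\<^sub>R h)) (scaleC \<i> (\<rho> *\<^sub>R h))))"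
      unfolding scaleC_scaleR D2_scaleR lap_def power2_norm_eq_inner[symmetric]
      by (simp add: norm_scaleC dot_square_norm power_mult_distrib algebra_simps)
    finally show "0 \<le> (- 1) * D2 u y (\<rho> *\<^sub>R h) (\<rho> *\<^sub>R h) + (- c) * (2 * inner (\<rho> *\<^sub>R h) (\<rho> *\<^sub>R h))
      + ((- 1) * D2 u y (scaleC \<i> (\<rho> *\<^sub>R h)) (scaleC \<i> (\<rho> *\<^sub>R h))
        + (- c) * (2 * inner (scaleC \<i> (\<rho> *\<^sub>R h)) (scaleC \<i> (\<rho> *\<^sub>R h))))" .
  qed
  also have "\<dots> = integral {0..2 * pi} (\<lambda>\<theta>. - u (z + scaleC (cis \<theta>) (\<rho> *\<^sub>R h)) - c * (norm (\<rho> *\<^sub>R h))\<^sup>2)"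
    by (simp add: norm_scaleC)
  also have "\<dots> = - integral {0..2 * pi} (\<lambda>\<theta>. u (z + scaleC (cis \<theta>) (\<rho> *\<^sub>R h))) - 2 * pi * (c * (norm (\<rho> *\<^sub>R h))\<^sup>2)"
    by (subst integral_diff)
      (use S disc in \<open>auto intro!: integrable_continuous_interval continuous_intros continuous_circle[OF cu]\<close>)
  finally have "integral {0..2 * pi} (\<lambda>\<theta>. u (z + scaleC (cis \<theta>) (\<rho> *\<^sub>R h))) + 2 * pi * (c * (norm (\<rho> *\<^sub>R h))\<^sup>2) \<le> 2 * pi * u z"
    by simp
  moreover have "2 * pi * u z \<le> integral {0..2 * pi} (\<lambda>\<theta>. u (z + scaleC (cis \<theta>) (\<rho> *\<^sub>R h)))"
    using psh psh_iff_continuous[OF cu] z S disc by blast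
  moreover have "0 < 2 * pi * (c * (norm (\<rho> *\<^sub>R h))\<^sup>2)" using c \<rho> h by simp
  ultimately show False by linarith
qed

text \<open>
  On the slice of \<open>closure \<Omega>\<close> by a complex line through \<open>z\<close>, which is compact, \<open>w\<close> attains its
  maximum. If it is positive, the maximum points lie over \<open>\<Omega>\<close>; take one with greatest real part. By the
  mean value inequality the maximum is attained on a whole small circle around it, in particular
  further to the right.
\<close>

lemma psh_maximum_principle:
  fixes w :: "'a::complex_hilbert \<Rightarrow> real"
  assumes nz: "\<exists>x::'a. x \<noteq> 0" and op: "open \<Omega>" and bdd: "bounded \<Omega>"
    and cont: "continuous_on (closure \<Omega>) w" and psh: "psh \<Omega> (\<lambda>z. ereal (w z))"
    and bnd: "\<And>z. z \<in> frontier \<Omega> \<Longrightarrow> w z \<le> 0" and z: "z \<in> \<Omega>"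
  shows "w z \<le> 0"
proof (rule ccontr)
  assume "\<not> w z \<le> 0"
  then have wz: "w z > 0" by simp
  obtain h :: 'a where h: "h \<noteq> 0" using nz by blast
  define L where "L = (\<lambda>l. z + scaleC l h)"
  define K where "K = L -` closure \<Omega>"
  have L0: "L 0 = z" by (simp add: L_def)
  have cL: "continuous_on T L" for T
    unfolding L_def by (intro continuous_intros)
  have "closed K" unfolding K_def by (rule closed_vimage[OF closed_closure cL])
  moreover have "bounded K"
  proof -
    obtain R where R: "\<And>y. y \<in> closure \<Omega> \<Longrightarrow> norm y \<le> R"
      using bounded_closure[OF bdd] unfolding bounded_iff by blast
    have "norm l \<le> (R + norm z) / norm h" if "l \<in> K" for l
    proof -
      have "norm (scaleC l h) \<le> norm (L l) + norm z"
        using norm_triangle_ineq4[of "L l" z] by (simp add: L_def)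
      also have "\<dots> \<le> R + norm z" using R that by (simp add: K_def)
      finally show ?thesis using h by (simp add: norm_scaleC field_simps)
    qed
    then show ?thesis unfolding bounded_iff by blast
  qed
  ultimately have K: "compact K" by (simp add: compact_eq_bounded_closed)
  have K0: "0 \<in> K" using z closure_subset by (auto simp: K_def L0)
  have cw: "continuous_on K (\<lambda>l. w (L l))"
    by (rule continuous_on_compose2[OF cont cL]) (auto simp: K_def)
  obtain l1 where l1: "l1 \<in> K" "\<And>l. l \<in> K \<Longrightarrow> w (L l) \<le> w (L l1)"
    using continuous_attains_sup[OF K _ cw] K0 by blast
  define T where "T = {l \<in> K. w (L l) = w (L l1)}"
  have "closedin (top_of_set K) T"
    unfolding T_def by (rule continuous_closedin_preimage_constant[OF cw])
  then have "compact T" using K closedin_compact by blast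
  then obtain l2 where l2: "l2 \<in> T" "\<And>l. l \<in> T \<Longrightarrow> Re l \<le> Re l2"
    using continuous_attains_sup[of T Re] l1(1) by (force simp: T_def intro: continuous_intros)
  have w2: "w (L l2) = w (L l1)" "L l2 \<in> closure \<Omega>" using l2(1) by (auto simp: T_def K_def)
  have "w (L l2) > 0" using l1(2)[OF K0] wz w2 by (simp add: L0)
  then have "L l2 \<notin> frontier \<Omega>" using bnd by (meson not_le)
  then have "L l2 \<in> \<Omega>" using w2(2) op by (simp add: frontier_def interior_open)
  then obtain r where r: "r > 0" "ball (L l2) r \<subseteq> \<Omega>" using op open_contains_ball by blast
  define \<rho> where "\<rho> = r / (2 * norm h)"
  have \<rho>: "\<rho> > 0" "norm (\<rho> *\<^sub>R h) < r" using r h by (auto simp: \<rho>_def)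
  have shift: "L l2 + scaleC l (\<rho> *\<^sub>R h) = L (l2 + complex_of_real \<rho> * l)" for l
    by (simp add: L_def scaleC_add_left scaleC_scaleC[symmetric] scaleC_of_real scaleC_scaleR)
  have disc: "L l2 + scaleC l (\<rho> *\<^sub>R h) \<in> \<Omega>" if "cmod l \<le> 1" for l
  proof -
    have "norm (scaleC l (\<rho> *\<^sub>R h)) \<le> norm (\<rho> *\<^sub>R h)"
      unfolding norm_scaleC using that by (intro mult_left_le_one_le) auto
    then show ?thesis using \<rho>(2) r(2) by (auto simp: dist_norm subset_iff)
  qed
  have cw': "continuous_on \<Omega> w" by (rule continuous_on_subset[OF cont closure_subset])
  let ?f = "\<lambda>\<theta>. w (L l2) - w (L l2 + scaleC (cis \<theta>) (\<rho> *\<^sub>R h))"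
  have inK: "l2 + complex_of_real \<rho> * l \<in> K" if "cmod l \<le> 1" for l
    using disc[OF that] closure_subset by (auto simp: K_def shift)
  have f0: "0 \<le> ?f \<theta>" for \<theta>
    using l1(2)[OF inK[of "cis \<theta>"]] w2 by (simp add: shift)
  have cc: "continuous_on {0..2 * pi} (\<lambda>\<theta>. w (L l2 + scaleC (cis \<theta>) (\<rho> *\<^sub>R h)))"
    by (rule continuous_circle[OF cw' disc])
  then have cf: "continuous_on {0..2 * pi} ?f" by (intro continuous_intros)
  have "2 * pi * w (L l2) \<le> integral {0..2 * pi} (\<lambda>\<theta>. w (L l2 + scaleC (cis \<theta>) (\<rho> *\<^sub>R h)))"
    using psh psh_iff_continuous[OF cw'] \<open>L l2 \<in> \<Omega>\<close> disc by blast
  moreover have "integral {0..2 * pi} ?f = 2 * pi * w (L l2) - integral {0..2 * pi} (\<lambda>\<theta>. w (L l2 + scaleC (cis \<theta>) (\<rho> *\<^sub>R h)))"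
    by (subst integral_diff) (use cc in \<open>auto intro: integrable_continuous_interval\<close>)
  moreover have "0 \<le> integral {0..2 * pi} ?f"
    by (rule integral_nonneg) (use f0 cf in \<open>auto intro: integrable_continuous_interval\<close>)
  ultimately have "integral {0..2 * pi} ?f = 0" by linarith
  then have "\<forall>\<theta>\<in>{0..2 * pi}. ?f \<theta> = 0" using integral_eq_0_iff[OF cf] f0 by simp
  then have "?f 0 = 0" by (rule bspec) simp
  then have "w (L (l2 + complex_of_real \<rho>)) = w (L l2)" using shift[of 1] by simp
  then have "l2 + complex_of_real \<rho> \<in> T" using inK[of 1] w2 by (simp add: T_def)
  then show False using l2(2) \<rho>(1) by fastforce
qed

section \<open>Comparison of plurisubharmonic functions\<close>

theorem theorem6p2:
  fixes \<Omega> :: "'a::complex_hilbert set"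
    and u v :: "'a \<Rightarrow> real"
    and m M :: real
  assumes "\<exists>x::'a. x \<noteq> 0"
    and "open \<Omega>" and "connected \<Omega>" and "\<Omega> \<noteq> {}" and "bounded \<Omega>"
    and "psh \<Omega> (\<lambda>z. ereal (u z))" and "C2_closure \<Omega> u"
    and "psh \<Omega> (\<lambda>z. ereal (v z))" and "C2_closure \<Omega> v"
    and "0 < m" and "m \<le> M"
    and "\<And>z. z \<in> \<Omega> \<Longrightarrow>
           op_le (m *\<^sub>R id_blinfun) (levi_op v z) \<and> op_le (levi_op v z) (M *\<^sub>R id_blinfun)"
    and "\<And>z. z \<in> frontier \<Omega> \<Longrightarrow> u z + specht_const m M * (norm z)\<^sup>2 \<le> v z"
    and "\<And>z x. z \<in> \<Omega> \<Longrightarrow> norm x = 1 \<Longrightarrow> fs_det x (levi_op v z) \<le> fs_det x (levi_op u z)"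
  shows "psh \<Omega> (\<lambda>z. ereal (u z + specht_const m M * (norm z)\<^sup>2 - v z))
    \<and> (\<forall>z\<in>\<Omega>. u z + specht_const m M * (norm z)\<^sup>2 - v z \<le> 0)"
proof -
  define C where "C = specht_const m M"
  define w where "w = (\<lambda>z. u z + C * (norm z)\<^sup>2 - v z)"
  have sym: "op_symmetric (levi_op f z)" if "C2_closure \<Omega> f" "z \<in> \<Omega>" for f z
    unfolding op_symmetric_def
    by (simp add: inner_levi_op inner_commute[of _ "blinfun_apply (levi_op f z) _"]
        D2_symmetric[OF \<open>open \<Omega>\<close> that])
  have levi: "0 \<le> (D2 u z h h + D2 u z (scaleC \<i> h) (scaleC \<i> h)) + 4 * C * (norm h)\<^sup>2
      - (D2 v z h h + D2 v z (scaleC \<i> h) (scaleC \<i> h))" if z: "z \<in> \<Omega>" for z h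
  proof -
    have "inner (levi_op v z h) h \<le> inner (levi_op u z h) h + specht_const m M * (norm h)\<^sup>2"
    proof (rule fs_det_le_imp_inner_le)
      show "0 \<le> inner (levi_op u z y) y" for y
        using psh_levi_nonneg[OF assms(2,7,6) z, of y] by (simp add: inner_levi_op)
      have "0 \<le> Re (cinner ((levi_op v z - m *\<^sub>R id_blinfun) y) y)"
        "0 \<le> Re (cinner ((M *\<^sub>R id_blinfun - levi_op v z) y) y)" for y
        using assms(12)[OF z] by (auto simp: op_le_def complex_nonneg_Reals_iff)
      then show "m * (norm y)\<^sup>2 \<le> inner (levi_op v z y) y" "inner (levi_op v z y) y \<le> M * (norm y)\<^sup>2" for y
        by (simp_all add: inner_eq_Re_cinner[symmetric] blinfun.diff_left blinfun.scaleR_left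
            inner_diff_left dot_square_norm)
    qed (use assms sym z in auto)
    then show ?thesis by (simp add: inner_levi_op C_def field_simps)
  qed
  have c: "continuous_on (closure \<Omega>) w"
    using assms(7,9) unfolding w_def C2_closure_def by (intro continuous_intros) auto
  have "psh \<Omega> (\<lambda>z. ereal (w z))"
  proof (subst psh_iff_continuous, goal_cases)
    case 1
    show ?case by (rule continuous_on_subset[OF c closure_subset])
  next
    case 2
    show ?case
    proof (intro ballI allI impI)
      fix z h assume "z \<in> \<Omega>" and disc: "\<forall>l. cmod l \<le> 1 \<longrightarrow> z + scaleC l h \<in> \<Omega>"
      have "2 * pi * (1 * (1 * u z + C * (norm (z - 0))\<^sup>2) + (- 1) * v z)
        \<le> integral {0..2 * pi} (\<lambda>\<theta>. 1 * (1 * u (z + scaleC (cis \<theta>) h) + C * (norm (z + scaleC (cis \<theta>) h - 0))\<^sup>2)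
          + (- 1) * v (z + scaleC (cis \<theta>) h))"
        by (rule C2_with_submean[OF C2_with_lincomb[OF C2_with_lincomb[OF C2_with_C2_closure[OF assms(7)]
            C2_with_norm_sq] C2_with_C2_closure[OF assms(9)]]])
          (use disc levi[of _ h] in \<open>auto simp: dot_square_norm norm_scaleC algebra_simps\<close>)
      then show "2 * pi * w z \<le> integral {0..2 * pi} (\<lambda>\<theta>. w (z + scaleC (cis \<theta>) h))"
        by (simp add: w_def)
    qed
  qed
  moreover from this have "w z \<le> 0" if "z \<in> \<Omega>" for z
    using psh_maximum_principle[OF assms(1,2,5) c _ _ that] assms(13) by (simp add: w_def C_def)
  ultimately show ?thesis by (simp add: w_def C_def)
qed

end
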